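(* Let $\pi\subset\mathbb{P}^3$ be a nondegenerate plane. For the Desargues configuration $D_\pi$ the following statements are equivalent: (1) $D_\pi$ is a special Desargues configuration. (2) The binary sextic $\Phi(D_\pi)$ (the Jacobian sextic of $D_\pi$) admits a double point, i.e. a double root.
   Context: Everything is over $\mathbb{C}$. In $\mathbb{P}^3$ fix $e_1=(1:0:0:0),\dots,e_4=(0:0:0:1),\ e_5=(1:1:1:1)$. A plane $\pi:\sum_{i=1}^4\alpha_iz_i=0$ is nondegenerate if it contains none of the $e_i$, i.e. all $\alpha_i\ne0$ and $\sum\alpha_i\neq0$. The Desargues configuration $D_\pi$ in $\pi$ consists of the 10 points $p_{ij}=\overline{e_ie_j}\cap\pi$ and the 10 lines $\ell_{ijk}=\overline{e_ie_je_k}\cap\pi$. The axis of $p_{ij}$ is $\ell_{klm}$, where $\{i,j,k,l,m\}=\{1,\dots,5\}$. $D_\pi$ is special if some point $p_{ij}$ lies on its axis (equivalently, one of its lines contains 4 configuration points; equivalently, $\pi$ contains one of the 10 points $\overline{e_ie_j}\cap\overline{e_ke_le_m}$). The von Staudt conic $s_\pi\subset\pi$ is the unique smooth conic such that the polar line of each $p_{ij}$ is its axis. For fixed $i$, the pencil of conics in $\pi$ through the four points $p_{ij}$, $j\ne i$, restricts on $s_\pi\cong\mathbb{P}^1$ to a pencil of binary quartics spanned by $f_1,f_2$; $\Phi(D_\pi)$ is the class of the binary sextic $J_\pi=\det(\partial f_i/\partial x_j)$, which up to a nonzero constant and an automorphism of $\mathbb{P}^1$ does not depend on choices (including $i$).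 Equivalently, its zero divisor is the degree 6 divisor on $s_\pi$ defined by $\sum\alpha_iz_i=\sum\alpha_iz_i^2=\sum\alpha_iz_i^3=0$. The sextic $J_\pi$ has no root of multiplicity $\ge 3$. *)

theory Defs
  imports "HOL-Analysis.Analysis"
begin

text \<open>
  Projective linear subspaces of $P^3$ are represented by the corresponding complex linear
  subspaces of \<^typ>\<open>complex^4\<close>: points by lines through the origin, and so on. Complex spans are
  formed with \<^const>\<open>vec.span\<close>; the plain \<^const>\<open>span\<close> is the real span.
\<close>

definition proj_points :: "(complex^'n) set \<Rightarrow> (complex^'n) set set" where
  "proj_points S = {vec.span {v} | v. v \<in> S \<and> v \<noteq> 0}"

subsection \<open>The Desargues configuration\<close>

definition base_point :: "nat \<Rightarrow> complex^4" where
  "base_point i = (if i = 5 then vec 1 else axis (of_nat i) 1)"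

definition plane :: "complex^4 \<Rightarrow> (complex^4) set" where
  "plane \<alpha> = {z. (\<Sum>i\<in>UNIV. \<alpha> $ i * z $ i) = 0}"

definition nondegenerate_plane :: "complex^4 \<Rightarrow> bool" where
  "nondegenerate_plane \<alpha> \<longleftrightarrow> (\<forall>i\<in>{1..5}. base_point i \<notin> plane \<alpha>)"

definition conf_point :: "complex^4 \<Rightarrow> nat \<Rightarrow> nat \<Rightarrow> (complex^4) set" where
  "conf_point \<alpha> i j = vec.span {base_point i, base_point j} \<inter> plane \<alpha>"

definition conf_line :: "complex^4 \<Rightarrow> nat \<Rightarrow> nat \<Rightarrow> nat \<Rightarrow> (complex^4) set" where
  "conf_line \<alpha> i j k = vec.span {base_point i, base_point j, base_point k} \<inter> plane \<alpha>"

definition special_configuration :: "complex^4 \<Rightarrow> bool" where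
  "special_configuration \<alpha> \<longleftrightarrow>
     (\<exists>i j k l m. {i, j, k, l, m} = {1..5} \<and> conf_point \<alpha> i j \<subseteq> conf_line \<alpha> k l m)"

subsection \<open>Conics and the von Staudt conic\<close>

text \<open>
  A conic in the plane is the restriction to it of a quadratic form on \<^typ>\<open>complex^4\<close>; every
  quadratic form on the plane arises in this way.
\<close>

definition bform :: "complex^4^4 \<Rightarrow> complex^4 \<Rightarrow> complex^4 \<Rightarrow> complex" where
  "bform M v w = (\<Sum>i\<in>UNIV. v $ i * (M *v w) $ i)"

definition polar :: "complex^4 \<Rightarrow> complex^4^4 \<Rightarrow> (complex^4) set \<Rightarrow> (complex^4) set" where
  "polar \<alpha> M p = {w \<in> plane \<alpha>. \<forall>v\<in>p. bform M v w = 0}"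

text \<open>
  For symmetric \<open>M\<close>, the condition \<open>bform M v w = 0\<close> for all \<open>w\<close> in the plane says that
  the differential of the form vanishes at \<open>v\<close>; it entails that \<open>v\<close> is on the conic.
\<close>

definition smooth_conic :: "complex^4 \<Rightarrow> complex^4^4 \<Rightarrow> bool" where
  "smooth_conic \<alpha> M \<longleftrightarrow>
     (\<forall>v\<in>plane \<alpha>. (\<forall>w\<in>plane \<alpha>. bform M v w = 0) \<longrightarrow> v = 0)"

definition von_Staudt_conic :: "complex^4 \<Rightarrow> complex^4^4 \<Rightarrow> bool" where
  "von_Staudt_conic \<alpha> M \<longleftrightarrow> transpose M = M \<and> smooth_conic \<alpha> M \<and>
     (\<forall>i j k l m. {i, j, k, l, m} = {1..5} \<longrightarrow> polar \<alpha> M (conf_point \<alpha> i j) = conf_line \<alpha> k l m)"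

definition conic_points :: "complex^4 \<Rightarrow> complex^4^4 \<Rightarrow> (complex^4) set set" where
  "conic_points \<alpha> M = proj_points {z \<in> plane \<alpha>. bform M z z = 0}"

subsection \<open>Binary forms\<close>

definition binary_form :: "nat \<Rightarrow> (complex^2 \<Rightarrow> complex) \<Rightarrow> bool" where
  "binary_form d F \<longleftrightarrow> (\<exists>c. \<forall>v. F v = (\<Sum>k\<le>d. c k * (v $ 1) ^ k * (v $ 2) ^ (d - k)))"

definition partial_deriv :: "2 \<Rightarrow> (complex^2 \<Rightarrow> complex) \<Rightarrow> complex^2 \<Rightarrow> complex" where
  "partial_deriv j F v = deriv (\<lambda>t. F (v + t *s axis j 1)) 0"

definition jacobian_det :: "(2 \<Rightarrow> complex^2 \<Rightarrow> complex) \<Rightarrow> complex^2 \<Rightarrow> complex" where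
  "jacobian_det f v = det ((\<chi> i j. partial_deriv j (f i) v) :: complex^2^2)"

definition root_of_multiplicity :: "nat \<Rightarrow> nat \<Rightarrow> (complex^2 \<Rightarrow> complex) \<Rightarrow> complex^2 \<Rightarrow> bool" where
  "root_of_multiplicity d m F p \<longleftrightarrow> p \<noteq> 0 \<and> m \<le> d \<and>
     (\<exists>G. binary_form (d - m) G \<and> G p \<noteq> 0 \<and>
        (\<forall>v. F v = (p $ 2 * v $ 1 - p $ 1 * v $ 2) ^ m * G v))"

definition has_double_root :: "nat \<Rightarrow> (complex^2 \<Rightarrow> complex) \<Rightarrow> bool" where
  "has_double_root d F \<longleftrightarrow> (\<exists>p. root_of_multiplicity d 2 F p)"

subsection \<open>The Jacobian sextic\<close>

text \<open>
  An isomorphism of $P^1$ with a smooth conic is given by binary quadratic forms. Conversely, a map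
  given by such forms that is bijective on points is an isomorphism, as the ground field has
  characteristic 0. Requiring the values of the induced map to lie in \<^const>\<open>conic_points\<close> excludes
  common zeros, because \<open>vec.span {0}\<close> is not a projective point.
\<close>

definition conic_isomorphism :: "complex^4 \<Rightarrow> complex^4^4 \<Rightarrow> (complex^2 \<Rightarrow> complex^4) \<Rightarrow> bool" where
  "conic_isomorphism \<alpha> M \<phi> \<longleftrightarrow> (\<forall>i. binary_form 2 (\<lambda>v. \<phi> v $ i)) \<and>
     bij_betw (\<lambda>L. vec.span (\<phi> ` L)) (proj_points UNIV) (conic_points \<alpha> M)"

definition restricted_pencil ::
    "complex^4 \<Rightarrow> (complex^2 \<Rightarrow> complex^4) \<Rightarrow> nat \<Rightarrow> (complex^2 \<Rightarrow> complex) set" where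
  "restricted_pencil \<alpha> \<phi> i =
     {(\<lambda>v. bform N (\<phi> v) (\<phi> v)) | N. \<forall>j\<in>{1..5} - {i}. \<forall>z\<in>conf_point \<alpha> i j. bform N z z = 0}"

text \<open>
  The Jacobian sextics obtained from all admissible choices. Up to nonzero scalars and linear
  changes of the two variables there is only one, so this set is the class $\Phi(D_\pi)$.
\<close>

definition jacobian_sextics :: "complex^4 \<Rightarrow> (complex^2 \<Rightarrow> complex) set" where
  "jacobian_sextics \<alpha> = {jacobian_det f | f M \<phi> i.
     von_Staudt_conic \<alpha> M \<and> conic_isomorphism \<alpha> M \<phi> \<and> i \<in> {1..5} \<and>
     restricted_pencil \<alpha> \<phi> i = {(\<lambda>v. a * f 1 v + b * f 2 v) | a b. True}}"

subsection \<open>Existence of the Jacobian sextic\<close>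

definition lf :: "complex^4 \<Rightarrow> complex^4 \<Rightarrow> complex" where
  "lf \<alpha> z = (\<Sum>i\<in>UNIV. \<alpha> $ i * z $ i)"

text \<open>
  The von Staudt conic is $\sum_i \alpha_i z_i^2 = 0$.
\<close>

definition diagm :: "complex^4 \<Rightarrow> complex^4^4" where
  "diagm \<alpha> = (\<chi> i j. if i = j then \<alpha> $ i else 0)"

definition coord5 :: "complex^4 \<Rightarrow> nat \<Rightarrow> complex" where
  "coord5 z i = (if i = 5 then 0 else z $ of_nat i)"

lemma plane_lf: "plane \<alpha> = {z. lf \<alpha> z = 0}"
  by (simp add: plane_def lf_def)

lemma lf_add: "lf \<alpha> (x + y) = lf \<alpha> x + lf \<alpha> y"
  by (simp add: lf_def sum_4 algebra_simps)

lemma lf_diff: "lf \<alpha> (x - y) = lf \<alpha> x - lf \<alpha> y"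
  by (simp add: lf_def sum_4 algebra_simps)

lemma lf_scale: "lf \<alpha> (c *s x) = c * lf \<alpha> x"
  by (simp add: lf_def sum_4 algebra_simps)

lemma bform_add_left: "bform M (x + y) w = bform M x w + bform M y w"
  by (simp add: bform_def sum_4 algebra_simps)

lemma bform_add_right: "bform M w (x + y) = bform M w x + bform M w y"
  by (simp add: bform_def sum_4 algebra_simps matrix_vector_right_distrib)

lemma bform_scale_left: "bform M (c *s x) w = c * bform M x w"
  by (simp add: bform_def sum_4 algebra_simps)

lemma bform_scale_right: "bform M w (c *s x) = c * bform M w x"
  by (simp add: bform_def sum_4 algebra_simps matrix_vector_mult_def)

lemma bform_diff_right: "bform M w (x - y) = bform M w x - bform M w y"
  using bform_add_right[of M w "x - y" y] by simp

lemma bform_diff_left: "bform M (x - y) w = bform M x w - bform M y w"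
  using bform_add_left[of M "x - y" y w] by simp

lemmas bform_linear = bform_add_left bform_add_right bform_scale_left bform_scale_right
  bform_diff_left bform_diff_right

lemma bform_diagm: "bform (diagm \<alpha>) v w =
    \<alpha>$1 * v$1 * w$1 + \<alpha>$2 * v$2 * w$2 + \<alpha>$3 * v$3 * w$3 + \<alpha>$4 * v$4 * w$4"
  by (simp add: bform_def diagm_def matrix_vector_mult_def sum_4)

lemma bform_diagm_sym: "bform (diagm \<alpha>) v w = bform (diagm \<alpha>) w v"
  by (simp add: bform_diagm)

lemma nat_15: "i \<in> {1..5::nat} \<longleftrightarrow> i = 1 \<or> i = 2 \<or> i = 3 \<or> i = 4 \<or> i = 5"
  by auto

lemma set_15: "{1..5::nat} = {1,2,3,4,5}"
  by auto

lemma bform_base_point: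
  assumes "i \<in> {1..5}" "w \<in> plane \<alpha>"
  shows "bform (diagm \<alpha>) (base_point i) w = lf \<alpha> (base_point i) * coord5 w i"
  using assms unfolding nat_15 plane_lf
  by (elim disjE) (simp_all add: bform_diagm base_point_def coord5_def axis_def lf_def sum_4)

lemma coord5_base_point:
  assumes "i \<in> {1..5}" "k \<in> {1..5}"
  shows "coord5 (base_point k) i =
    (if k = 5 then (if i = 5 then 0 else 1) else if i = k then 1 else 0)"
  using assms unfolding nat_15
  by (elim disjE) (simp_all add: coord5_def base_point_def axis_def)

lemma span_base_point:
  assumes "i \<in> {1..5}" "j \<in> {1..5}" "i \<noteq> j"
  shows "vec.span (base_point ` ({1..5} - {i, j})) = {z. coord5 z i = coord5 z j}"
proof
  have "vec.subspace {z. coord5 z i = coord5 z j}"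
    by (auto simp: vec.subspace_def coord5_def)
  moreover have "base_point ` ({1..5} - {i, j}) \<subseteq> {z. coord5 z i = coord5 z j}"
    using assms by (auto simp: coord5_base_point simp del: atLeastAtMost_iff)
  ultimately show "vec.span (base_point ` ({1..5} - {i, j})) \<subseteq> {z. coord5 z i = coord5 z j}"
    by (rule vec.span_minimal[rotated])
next
  show "{z. coord5 z i = coord5 z j} \<subseteq> vec.span (base_point ` ({1..5} - {i, j}))"
  proof
    fix z assume "z \<in> {z. coord5 z i = coord5 z j}"
    then have z: "coord5 z i = coord5 z j" by simp
    define t where "t = coord5 z i"
    define d where "d k = (if k = 5 then t else coord5 z k - t)" for k
    have "z = (\<Sum>k\<in>{1..5}. d k *s base_point k)"
      unfolding set_15
      by (simp add: vec_eq_iff forall_4 d_def base_point_def coord5_def axis_def)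
    moreover have "d k *s base_point k \<in> vec.span (base_point ` ({1..5} - {i, j}))"
      if "k \<in> {1..5}" for k
    proof (cases "k \<in> {i, j}")
      case True
      then have "d k = 0" using z by (auto simp: d_def t_def coord5_def)
      then show ?thesis by (simp add: vec.span_zero)
    next
      case False
      then show ?thesis using that by (intro vec.span_scale vec.span_base) auto
    qed
    ultimately show "z \<in> vec.span (base_point ` ({1..5} - {i, j}))"
      using vec.span_sum[of "{1..5}" "\<lambda>k. d k *s base_point k"] by auto
  qed
qed

lemma conf_point_iff:
  "z \<in> conf_point \<alpha> i j \<longleftrightarrow> (\<exists>a b. z = a *s base_point i + b *s base_point j \<and>
     a * lf \<alpha> (base_point i) + b * lf \<alpha> (base_point j) = 0)"
proof -
  have "z \<in> vec.span {base_point i, base_point j} \<longleftrightarrow>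
      (\<exists>a b. z = a *s base_point i + b *s base_point j)"
    by (auto simp: vec.span_insert algebra_simps)
  then show ?thesis
    unfolding conf_point_def plane_lf Int_iff mem_Collect_eq
    by (metis lf_add lf_scale)
qed

lemma diagm_perp_conf_point:
  assumes "i \<in> {1..5}" "j \<in> {1..5}" "nondegenerate_plane \<alpha>" "w \<in> plane \<alpha>"
  shows "(\<forall>v\<in>conf_point \<alpha> i j. bform (diagm \<alpha>) v w = 0) \<longleftrightarrow> coord5 w i = coord5 w j"
proof -
  let ?g = "\<lambda>k. lf \<alpha> (base_point k)"
  have g: "?g i \<noteq> 0" "?g j \<noteq> 0"
    using assms by (auto simp: nondegenerate_plane_def plane_lf)
  have B: "bform (diagm \<alpha>) (a *s base_point i + b *s base_point j) w =
      a * ?g i * coord5 w i + b * ?g j * coord5 w j" for a b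
    using assms by (simp add: bform_linear bform_base_point)
  show ?thesis
  proof
    assume *: "\<forall>v\<in>conf_point \<alpha> i j. bform (diagm \<alpha>) v w = 0"
    have "?g j *s base_point i + (- ?g i) *s base_point j \<in> conf_point \<alpha> i j"
      unfolding conf_point_iff by (intro exI conjI, rule refl) simp
    from bspec[OF * this] have "?g j * ?g i * (coord5 w i - coord5 w j) = 0"
      unfolding B by (simp add: algebra_simps)
    then show "coord5 w i = coord5 w j" using g by simp
  next
    assume eq: "coord5 w i = coord5 w j"
    show "\<forall>v\<in>conf_point \<alpha> i j. bform (diagm \<alpha>) v w = 0"
    proof
      fix v assume "v \<in> conf_point \<alpha> i j"
      then obtain a b where v: "v = a *s base_point i + b *s base_point j"
        and ab: "a * ?g i + b * ?g j = 0" unfolding conf_point_iff by blast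
      have "bform (diagm \<alpha>) v w = (a * ?g i + b * ?g j) * coord5 w j"
        unfolding v B eq by (simp add: algebra_simps)
      then show "bform (diagm \<alpha>) v w = 0" using ab by simp
    qed
  qed
qed

lemma perm_15:
  assumes "{i, j, k, l, m} = {1..5::nat}"
  shows "i \<in> {1..5}" "j \<in> {1..5}" "i \<noteq> j" "{k, l, m} = {1..5} - {i, j}"
proof -
  have c: "card {i, j, k, l, m} = 5" using assms by simp
  have "length [i, j, k, l, m] = card (set [i, j, k, l, m])" using c by simp
  then have "distinct [i, j, k, l, m]" by (metis card_distinct)
  then show "i \<noteq> j" "{k, l, m} = {1..5} - {i, j}" unfolding assms[symmetric] by auto
  show "i \<in> {1..5}" "j \<in> {1..5}" using assms by auto
qed

lemma smooth_diagm:
  assumes "nondegenerate_plane \<alpha>"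
  shows "smooth_conic \<alpha> (diagm \<alpha>)"
  unfolding smooth_conic_def
proof (intro ballI impI)
  fix v assume v: "v \<in> plane \<alpha>" and *: "\<forall>w\<in>plane \<alpha>. bform (diagm \<alpha>) v w = 0"
  have "coord5 v i = coord5 v 5" if "i \<in> {1..5}" for i
  proof -
    have "\<forall>w\<in>conf_point \<alpha> i 5. bform (diagm \<alpha>) w v = 0"
      using * by (auto simp: bform_diagm_sym[of \<alpha> _ v] conf_point_def)
    then show ?thesis
      using diagm_perp_conf_point[OF that _ assms v, of 5] by simp
  qed
  from this[of 1] this[of 2] this[of 3] this[of 4] show "v = 0"
    by (simp add: coord5_def vec_eq_iff forall_4)
qed

lemma von_Staudt_diagm:
  assumes "nondegenerate_plane \<alpha>"
  shows "von_Staudt_conic \<alpha> (diagm \<alpha>)"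
  unfolding von_Staudt_conic_def
proof (intro conjI allI impI)
  show "transpose (diagm \<alpha>) = diagm \<alpha>"
    by (simp add: transpose_def diagm_def vec_eq_iff)
  show "smooth_conic \<alpha> (diagm \<alpha>)" by (rule smooth_diagm[OF assms])
  fix i j k l m :: nat assume "{i, j, k, l, m} = {1..5}"
  note p = perm_15[OF this]
  have "conf_line \<alpha> k l m = vec.span (base_point ` {k, l, m}) \<inter> plane \<alpha>"
    by (simp add: conf_line_def)
  also have "\<dots> = {z. coord5 z i = coord5 z j} \<inter> plane \<alpha>"
    using p span_base_point by simp
  also have "\<dots> = polar \<alpha> (diagm \<alpha>) (conf_point \<alpha> i j)"
    using diagm_perp_conf_point[OF p(1,2) assms] by (auto simp: polar_def)
  finally show "polar \<alpha> (diagm \<alpha>) (conf_point \<alpha> i j) = conf_line \<alpha> k l m" by simp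
qed


lemma nondegenerate_plane_nonzero:
  assumes "nondegenerate_plane \<alpha>"
  shows "lf \<alpha> 1 \<noteq> 0" "\<alpha> $ 1 \<noteq> 0"
proof -
  have *: "lf \<alpha> (base_point i) \<noteq> 0" if "i \<in> {1..5}" for i
    using assms that by (auto simp: nondegenerate_plane_def plane_lf)
  show "lf \<alpha> 1 \<noteq> 0" using *[of 5] by (simp add: base_point_def)
  show "\<alpha> $ 1 \<noteq> 0" using *[of 1] by (simp add: base_point_def lf_def sum_4 axis_def)
qed

lemma adc_span:
  fixes \<alpha> a d c z :: "complex^4"
  defines "B \<equiv> bform (diagm \<alpha>)"
  assumes nd: "nondegenerate_plane \<alpha>"
    and pl: "a \<in> plane \<alpha>" "d \<in> plane \<alpha>" "c \<in> plane \<alpha>"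
    and B: "B a a = 0" "B c c = 0" "B a d = 0" "B c d = 0" "B a c \<noteq> 0"
    and d: "d \<noteq> 0" and z: "z \<in> plane \<alpha>"
  shows "\<exists>u v w. z = u *s a + v *s d + w *s c"
proof -
  define C :: "complex^4^4" where
    "C = (\<chi> i j. if j = 1 then a $ i else if j = 2 then d $ i else if j = 3 then c $ i else 1)"
  have C: "C *v x = x$1 *s a + x$2 *s d + x$3 *s c + x$4 *s 1" for x
    by (simp add: C_def vec_eq_iff matrix_vector_mult_def sum_4)
  have sym: "B x y = B y x" for x y unfolding B_def by (rule bform_diagm_sym)
  have Bv: "B x 1 = lf \<alpha> x" for x
    by (simp add: B_def bform_diagm lf_def sum_4)
  have l: "lf \<alpha> a = 0" "lf \<alpha> d = 0" "lf \<alpha> c = 0" "lf \<alpha> z = 0"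
    using pl z by (auto simp: plane_lf)
  note lin = bform_linear[of "diagm \<alpha>", folded B_def]
  have "x = 0" if "C *v x = 0" for x
  proof -
    have e: "x$1 *s a + x$2 *s d + x$3 *s c + x$4 *s 1 = 0" (is "?e = 0") using that C by simp
    have z0: "B y 0 = 0" for y using lin(4)[of y 0 0] by simp
    have "B c ?e = x$1 * B a c" using B l by (simp add: lin Bv sym[of c a])
    then have 1: "x$1 = 0" using B z0 e by simp
    have "B a ?e = x$3 * B a c" using B l by (simp add: lin Bv)
    then have 3: "x$3 = 0" using B z0 e by simp
    have "lf \<alpha> ?e = x$4 * lf \<alpha> 1" using l by (simp add: lf_add lf_scale)
    moreover have "lf \<alpha> 0 = 0" by (simp add: lf_def)
    ultimately have 4: "x$4 = 0" using e nondegenerate_plane_nonzero(1)[OF nd] by simp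
    have "x$2 *s d = 0" using e 1 3 4 by simp
    then have "x$2 = 0" using d by simp
    with 1 3 4 show "x = 0" by (simp add: vec_eq_iff forall_4)
  qed
  then obtain D where "D ** C = mat 1" using matrix_left_invertible_ker[of C] by blast
  then have "C ** D = mat 1" by (simp add: matrix_left_right_inverse)
  then have "C *v (D *v z) = z" by (metis matrix_vector_mul_assoc matrix_vector_mul_lid)
  then obtain x :: "complex^4" where x: "z = x$1 *s a + x$2 *s d + x$3 *s c + x$4 *s 1"
    using C by metis
  have "lf \<alpha> z = x$4 * lf \<alpha> 1" unfolding x using l by (simp add: lf_add lf_scale)
  then have "x$4 = 0" using l nondegenerate_plane_nonzero(1)[OF nd] by simp
  then show ?thesis using x by auto
qed

lemma three_equations:
  fixes p q r :: "complex^4"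
  shows "\<exists>d. d \<noteq> 0 \<and> lf p d = 0 \<and> lf q d = 0 \<and> lf r d = 0"
proof (rule ccontr)
  assume *: "\<not> ?thesis"
  define C :: "complex^4^4" where
    "C = (\<chi> i j. if i = 1 then p $ j else if i = 2 then q $ j else if i = 3 then r $ j else 0)"
  have "x = 0" if "C *v x = 0" for x
  proof -
    have "lf p x = 0 \<and> lf q x = 0 \<and> lf r x = 0"
      using that by (simp add: vec_eq_iff forall_4 C_def matrix_vector_mult_def lf_def)
    then show "x = 0" using * by blast
  qed
  then obtain D where "D ** C = mat 1" using matrix_left_invertible_ker[of C] by blast
  then have "C ** D = mat 1" by (simp add: matrix_left_right_inverse)
  then have "(C ** D) $ 4 $ 4 = 1" by (simp add: mat_def)
  then show False by (simp add: C_def matrix_matrix_mult_def)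
qed

lemma isotropic_point:
  assumes nd: "nondegenerate_plane \<alpha>"
  shows "\<exists>a. a \<in> plane \<alpha> \<and> a \<noteq> 0 \<and> bform (diagm \<alpha>) a a = 0"
proof -
  let ?B = "bform (diagm \<alpha>)"
  define v :: "complex^4" where "v = \<alpha>$2 *s axis 1 1 - \<alpha>$1 *s axis 2 1"
  define w :: "complex^4" where "w = \<alpha>$3 *s axis 1 1 - \<alpha>$1 *s axis 3 1"
  have pl: "v \<in> plane \<alpha>" "w \<in> plane \<alpha>"
    by (simp_all add: plane_lf lf_def sum_4 v_def w_def axis_def)
  have nz: "v $ 2 \<noteq> 0" "w $ 2 = 0" "w $ 3 \<noteq> 0"
    using nondegenerate_plane_nonzero(2)[OF nd] by (simp_all add: v_def w_def axis_def)
  show ?thesis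
  proof (cases "?B w w = 0")
    case True
    then show ?thesis using pl nz by (metis zero_index)
  next
    case False
    define s where "s = csqrt ((?B v w)\<^sup>2 - ?B v v * ?B w w)"
    define t where "t = (s - ?B v w) / ?B w w"
    have t: "t * ?B w w = s - ?B v w" using False by (simp add: t_def)
    have s: "s * s = ?B v w * ?B v w - ?B v v * ?B w w"
      using power2_csqrt[of "(?B v w)\<^sup>2 - ?B v v * ?B w w"]
      by (simp add: s_def power2_eq_square)
    have "?B (v + t *s w) (v + t *s w) = ?B v v + 2 * t * ?B v w + t * (t * ?B w w)"
      by (simp add: bform_linear bform_diagm_sym[of \<alpha> w v] algebra_simps)
    also have "?B w w * \<dots> = ?B w w * ?B v v + 2 * (t * ?B w w) * ?B v w + (t * ?B w w) * (t * ?B w w)"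
      by (simp add: algebra_simps)
    also have "\<dots> = 0" unfolding t using s by (simp add: algebra_simps)
    finally have "?B (v + t *s w) (v + t *s w) = 0" using False by simp
    moreover have "v + t *s w \<in> plane \<alpha>" using pl by (simp add: plane_lf lf_add lf_scale)
    moreover have "(v + t *s w) $ 2 \<noteq> 0" using nz by simp
    ultimately show ?thesis by (metis zero_index)
  qed
qed

lemma adc_exists:
  assumes nd: "nondegenerate_plane \<alpha>"
  shows "\<exists>a d c. a \<in> plane \<alpha> \<and> d \<in> plane \<alpha> \<and> c \<in> plane \<alpha> \<and>
    bform (diagm \<alpha>) a a = 0 \<and> bform (diagm \<alpha>) c c = 0 \<and>
    bform (diagm \<alpha>) a d = 0 \<and> bform (diagm \<alpha>) c d = 0 \<and>
    bform (diagm \<alpha>) a c \<noteq> 0 \<and> d \<noteq> 0 \<and> bform (diagm \<alpha>) d d = - 2 * bform (diagm \<alpha>) a c"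
proof -
  let ?B = "bform (diagm \<alpha>)"
  obtain a where a: "a \<in> plane \<alpha>" "a \<noteq> 0" "?B a a = 0" using isotropic_point[OF nd] by blast
  obtain w where w: "w \<in> plane \<alpha>" "?B a w \<noteq> 0"
    using smooth_diagm[OF nd] a unfolding smooth_conic_def by blast
  define k where "k = ?B w w / (2 * ?B a w)"
  define c where "c = w - k *s a"
  have k: "2 * k * ?B a w = ?B w w" using w by (simp add: k_def)
  have ac: "?B a c = ?B a w" using a by (simp add: c_def bform_linear)
  have "?B c c = ?B w w - 2 * k * ?B a w"
    using a by (simp add: c_def bform_linear bform_diagm_sym[of \<alpha> w a] algebra_simps)
  then have c: "c \<in> plane \<alpha>" "?B c c = 0" "?B a c \<noteq> 0"
    using k w a ac by (simp_all add: c_def plane_lf lf_diff lf_scale)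
  have Bl: "?B x y = lf (\<chi> i. \<alpha>$i * x$i) y" for x y
    by (simp add: bform_diagm lf_def sum_4)
  obtain d where d: "d \<noteq> 0" "lf \<alpha> d = 0" "?B a d = 0" "?B c d = 0"
    using three_equations[of \<alpha> "\<chi> i. \<alpha>$i * a$i" "\<chi> i. \<alpha>$i * c$i"] unfolding Bl by blast
  have dp: "d \<in> plane \<alpha>" using d by (simp add: plane_lf)
  have dd: "?B d d \<noteq> 0"
  proof
    assume 0: "?B d d = 0"
    have "?B d z = 0" if zp: "z \<in> plane \<alpha>" for z
    proof -
      obtain u v w where "z = u *s a + v *s d + w *s c"
        using adc_span[OF nd a(1) dp c(1) a(3) c(2) d(3,4) c(3) d(1) zp] by blast
      then show ?thesis
        using 0 d by (simp add: bform_linear bform_diagm_sym[of \<alpha> d a] bform_diagm_sym[of \<alpha> d c])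
    qed
    then show False using smooth_diagm[OF nd] dp d(1) unfolding smooth_conic_def by blast
  qed
  define s where "s = csqrt (- 2 * ?B a c / ?B d d)"
  have s2: "s * s = - 2 * ?B a c / ?B d d"
    using power2_csqrt[of "- 2 * ?B a c / ?B d d"] by (simp add: s_def power2_eq_square)
  then have s0: "s \<noteq> 0" using c dd by auto
  have "?B (s *s d) (s *s d) = (s * s) * ?B d d" by (simp add: bform_linear)
  then have "?B (s *s d) (s *s d) = - 2 * ?B a c" using dd s2 by simp
  moreover have "s *s d \<in> plane \<alpha>" using d by (simp add: plane_lf lf_scale)
  ultimately show ?thesis
    using a c d s0
    by (intro exI[of _ a] exI[of _ "s *s d"] exI[of _ c]) (simp add: bform_linear)
qed

lemma span_singleton_iff: "x \<in> vec.span {y} \<longleftrightarrow> (\<exists>k. x = k *s (y::complex^'n))"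
  by (auto simp: vec.span_singleton)

lemma span_singleton_eqD:
  assumes "vec.span {x} = vec.span {y :: complex^'n}"
  shows "\<exists>k. x = k *s y"
  using assms vec.span_base[of x "{x}"] by (simp add: span_singleton_iff[symmetric])

lemma span_singleton_scale:
  assumes "k \<noteq> 0"
  shows "vec.span {k *s (y :: complex^'n)} = vec.span {y}"
proof -
  have "y = inverse k *s (k *s y)" using assms by (simp add: vector_smult_assoc)
  then show ?thesis
    by (intro equalityI vec.span_minimal) (auto simp: span_singleton_iff intro: exI[of _ k])
qed

lemma conic_isomorphism_exists:
  assumes nd: "nondegenerate_plane \<alpha>"
  shows "\<exists>\<phi>. conic_isomorphism \<alpha> (diagm \<alpha>) \<phi> \<and> (\<forall>v. \<phi> v \<in> plane \<alpha>)"
proof -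
  let ?B = "bform (diagm \<alpha>)"
  obtain a d c where pl: "a \<in> plane \<alpha>" "d \<in> plane \<alpha>" "c \<in> plane \<alpha>"
    and B: "?B a a = 0" "?B c c = 0" "?B a d = 0" "?B c d = 0" "?B a c \<noteq> 0" "d \<noteq> 0"
      "?B d d = - 2 * ?B a c"
    using adc_exists[OF nd] by blast
  have l: "lf \<alpha> a = 0" "lf \<alpha> d = 0" "lf \<alpha> c = 0" using pl by (auto simp: plane_lf)
  note BB = B bform_diagm_sym[of \<alpha> d a] bform_diagm_sym[of \<alpha> d c] bform_diagm_sym[of \<alpha> c a]
  have Bc: "?B a (u *s a + v *s d + w *s c) = w * ?B a c"
    "?B c (u *s a + v *s d + w *s c) = u * ?B a c"
    "?B d (u *s a + v *s d + w *s c) = - 2 * v * ?B a c" for u v w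
    using BB by (simp_all add: bform_linear)
  have Q: "?B (u *s a + v *s d + w *s c) (u *s a + v *s d + w *s c) = 2 * (u * w - v * v) * ?B a c"
    for u v w
    unfolding bform_add_left bform_scale_left Bc by (simp add: algebra_simps)
  have inj: "u = u' \<and> v = v' \<and> w = w'"
    if "u *s a + v *s d + w *s c = u' *s a + v' *s d + w' *s c" for u v w u' v' w'
    using Bc[of u v w] Bc[of u' v' w'] B that by simp
  define \<phi> :: "complex^2 \<Rightarrow> complex^4" where
    "\<phi> v = (v$1 * v$1) *s a + (v$1 * v$2) *s d + (v$2 * v$2) *s c" for v
  have \<phi>p: "\<phi> v \<in> plane \<alpha>" for v
    using l by (simp add: \<phi>_def plane_lf lf_add lf_scale)
  have \<phi>0: "v = 0" if "\<phi> v = 0" for v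
    using inj[of "v$1 * v$1" "v$1 * v$2" "v$2 * v$2" 0 0 0] that
    by (simp add: \<phi>_def vec_eq_iff forall_2)
  have \<phi>s: "\<phi> (k *s v) = (k * k) *s \<phi> v" for k v
    by (simp add: \<phi>_def vec_eq_iff algebra_simps)
  have img: "vec.span (\<phi> ` vec.span {v}) = vec.span {\<phi> v}" for v
  proof (intro equalityI vec.span_minimal vec.subspace_span)
    show "\<phi> ` vec.span {v} \<subseteq> vec.span {\<phi> v}"
      by (auto simp: span_singleton_iff \<phi>s)
    have "v \<in> vec.span {v}" by (simp add: vec.span_base)
    then show "{\<phi> v} \<subseteq> vec.span (\<phi> ` vec.span {v})" by (simp add: vec.span_base)
  qed
  have Q\<phi>: "?B (\<phi> v) (\<phi> v) = 0" for v unfolding \<phi>_def Q by simp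
  have "binary_form 2 (\<lambda>v. \<phi> v $ i)" for i
    unfolding binary_form_def
    by (rule exI[of _ "\<lambda>k. if k = 2 then a $ i else if k = 1 then d $ i else c $ i"])
      (simp add: \<phi>_def numeral_2_eq_2 algebra_simps)
  moreover have "bij_betw (\<lambda>L. vec.span (\<phi> ` L)) (proj_points UNIV) (conic_points \<alpha> (diagm \<alpha>))"
    unfolding bij_betw_def
  proof
    show "inj_on (\<lambda>L. vec.span (\<phi> ` L)) (proj_points UNIV)"
    proof (rule inj_onI)
      fix L L' assume "L \<in> proj_points UNIV" "L' \<in> proj_points UNIV"
        and eq: "vec.span (\<phi> ` L) = vec.span (\<phi> ` L')"
      then obtain v v' where L: "L = vec.span {v}" "v \<noteq> 0" "L' = vec.span {v'}" "v' \<noteq> 0"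
        by (auto simp: proj_points_def)
      then have "vec.span {\<phi> v'} = vec.span {\<phi> v}" using eq img by simp
      from span_singleton_eqD[OF this] obtain k where k: "\<phi> v' = k *s \<phi> v" by blast
      then have e: "v'$1 * v'$1 = k * (v$1 * v$1)" "v'$1 * v'$2 = k * (v$1 * v$2)"
        "v'$2 * v'$2 = k * (v$2 * v$2)"
        using inj[of "v'$1 * v'$1" "v'$1 * v'$2" "v'$2 * v'$2"
            "k * (v$1 * v$1)" "k * (v$1 * v$2)" "k * (v$2 * v$2)"]
        by (simp_all add: \<phi>_def vector_add_ldistrib vector_smult_assoc)
      have "k \<noteq> 0" using k \<phi>0 L by auto
      have "\<exists>r. r \<noteq> 0 \<and> v' = r *s v"
      proof (cases "v$1 = 0")
        case True
        then have "v'$1 = 0" "v$2 \<noteq> 0" using e L by (auto simp: vec_eq_iff forall_2)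
        then show ?thesis using True L
          by (intro exI[of _ "v'$2 / v$2"]) (auto simp: vec_eq_iff forall_2)
      next
        case False
        then have n: "v'$1 \<noteq> 0" using e \<open>k \<noteq> 0\<close> by auto
        have "v'$1 * (v'$2 * v$1) = (v'$1 * v'$2) * v$1" by simp
        also have "\<dots> = (v'$1 * v'$1) * v$2" unfolding e by simp
        finally have "v'$1 * (v'$2 * v$1) = v'$1 * (v'$1 * v$2)" by simp
        then have "v'$2 * v$1 = v'$1 * v$2" using n by simp
        then show ?thesis using False n
          by (intro exI[of _ "v'$1 / v$1"]) (auto simp: vec_eq_iff forall_2 field_simps)
      qed
      then show "L = L'" using L span_singleton_scale by metis
    qed
    show "(\<lambda>L. vec.span (\<phi> ` L)) ` proj_points UNIV = conic_points \<alpha> (diagm \<alpha>)"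
    proof (intro equalityI subsetI)
      fix P assume "P \<in> (\<lambda>L. vec.span (\<phi> ` L)) ` proj_points UNIV"
      then obtain v where "v \<noteq> 0" "P = vec.span {\<phi> v}"
        unfolding proj_points_def using img by auto
      then show "P \<in> conic_points \<alpha> (diagm \<alpha>)"
        unfolding conic_points_def proj_points_def using \<phi>p Q\<phi> \<phi>0 by blast
    next
      fix P assume "P \<in> conic_points \<alpha> (diagm \<alpha>)"
      then obtain z where z: "P = vec.span {z}" "z \<in> plane \<alpha>" "z \<noteq> 0" "?B z z = 0"
        unfolding conic_points_def proj_points_def by auto
      obtain u v w where uvw: "z = u *s a + v *s d + w *s c"
        using adc_span[OF nd pl B(1-6) z(2)] by blast
      have q: "u * w = v * v" using z Q B unfolding uvw by simp
      define x where "x = (if u = 0 then 0 else csqrt u)"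
      define y where "y = (if u = 0 then csqrt w else v / csqrt u)"
      have sq: "csqrt t * csqrt t = t" for t
        using power2_csqrt[of t] by (simp add: power2_eq_square)
      have xy: "x * x = u" "x * y = v" "y * y = w"
        using q by (auto simp: x_def y_def sq field_simps)
      let ?v = "(\<chi> i. if i = 1 then x else y) :: complex^2"
      have "\<phi> ?v = z" unfolding uvw \<phi>_def using xy by simp
      moreover have "?v \<noteq> 0"
      proof
        assume "?v = 0"
        then have "x = 0" "y = 0" by (auto simp: vec_eq_iff forall_2)
        then show False using z(3) uvw xy by simp
      qed
      ultimately show "P \<in> (\<lambda>L. vec.span (\<phi> ` L)) ` proj_points UNIV"
        unfolding z(1) proj_points_def using img by (auto intro!: image_eqI[of _ _ "vec.span {?v}"])
    qed
  qed
  ultimately show ?thesis unfolding conic_isomorphism_def using \<phi>p by blast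
qed

lemma pencil_five:
  assumes nd: "nondegenerate_plane \<alpha>"
    and N: "\<forall>j\<in>{1..5} - {5}. \<forall>z\<in>conf_point \<alpha> 5 j. bform N z z = 0"
  shows "\<exists>a b. \<forall>z\<in>plane \<alpha>. bform N z z =
    a * ((z$2 - z$4) * (z$1 - z$3)) + b * ((z$3 - z$4) * (z$1 - z$2))"
proof -
  let ?A = "lf \<alpha> 1"
  have A: "?A \<noteq> 0" using nondegenerate_plane_nonzero[OF nd] by simp
  have lA: "?A = \<alpha>$1 + \<alpha>$2 + \<alpha>$3 + \<alpha>$4" by (simp add: lf_def sum_4)
  define y where "y j = \<alpha> $ of_nat j *s base_point 5 - ?A *s base_point j" for j :: nat
  have y: "bform N (y j) (y j) = 0" if "j \<in> {1,2,3,4}" for j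
  proof -
    have "lf \<alpha> (base_point j) = \<alpha> $ of_nat j" "base_point 5 = 1"
      using that by (auto simp: base_point_def lf_def sum_4 axis_def)
    then have "y j \<in> conf_point \<alpha> 5 j"
      unfolding conf_point_iff y_def
      by (intro exI[of _ "\<alpha> $ of_nat j"] exI[of _ "- ?A"]) simp
    then show ?thesis using N that by (auto simp: set_15)
  qed
  define S where "S j k = bform N (y j) (y k) + bform N (y k) (y j)" for j k
  have y4: "y 4 = (-1) *s (y 1 + y 2 + y 3)"
    by (simp add: y_def vec_eq_iff forall_4 base_point_def axis_def lA algebra_simps)
  have "bform N (y 4) (y 4) = S 1 2 + S 1 3 + S 2 3"
    unfolding y4 bform_linear using y[of 1] y[of 2] y[of 3] by (simp add: S_def)
  then have S: "S 2 3 = - S 1 2 - S 1 3" using y[of 4] by (simp add: algebra_simps eq_neg_iff_add_eq_0)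
  show ?thesis
  proof (intro exI ballI)
    fix z assume z: "z \<in> plane \<alpha>"
    define x where "x k = (z $ 4 - z $ k) / ?A" for k
    have x: "?A * x k = z $ 4 - z $ k" for k using A by (simp add: x_def)
    have "\<alpha>$1 * z$1 + \<alpha>$2 * z$2 + \<alpha>$3 * z$3 + \<alpha>$4 * z$4 = 0"
      using z by (simp add: plane_lf lf_def sum_4)
    then have "\<alpha>$1 * (z$4 - z$1) + \<alpha>$2 * (z$4 - z$2) + \<alpha>$3 * (z$4 - z$3) = ?A * z$4"
      unfolding lA by (simp add: algebra_simps)
    then have "?A * (x 1 * \<alpha>$1 + x 2 * \<alpha>$2 + x 3 * \<alpha>$3) = ?A * z$4"
      unfolding x[symmetric] by (simp add: algebra_simps)
    then have c: "x 1 * \<alpha>$1 + x 2 * \<alpha>$2 + x 3 * \<alpha>$3 = z$4" using A by simp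
    have zz: "z = x 1 *s y 1 + x 2 *s y 2 + x 3 *s y 3"
      using c x[of 1] x[of 2] x[of 3]
      by (simp add: y_def vec_eq_iff forall_4 base_point_def axis_def algebra_simps)
    have "bform N z z = x 1 * x 2 * S 1 2 + x 1 * x 3 * S 1 3 + x 2 * x 3 * S 2 3"
      unfolding zz using y[of 1] y[of 2] y[of 3] by (simp add: bform_linear S_def algebra_simps)
    also have "\<dots> = S 1 2 * (x 2 * (x 1 - x 3)) + S 1 3 * (x 3 * (x 1 - x 2))"
      unfolding S by (simp add: algebra_simps)
    also have "x 2 * (x 1 - x 3) = (z$2 - z$4) * (z$1 - z$3) / ?A\<^sup>2"
      unfolding x_def diff_divide_distrib[symmetric] times_divide_times_eq
      by (simp add: power2_eq_square algebra_simps)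
    also have "x 3 * (x 1 - x 2) = (z$3 - z$4) * (z$1 - z$2) / ?A\<^sup>2"
      unfolding x_def diff_divide_distrib[symmetric] times_divide_times_eq
      by (simp add: power2_eq_square algebra_simps)
    finally show "bform N z z = (S 1 2 / ?A\<^sup>2) * ((z$2 - z$4) * (z$1 - z$3)) +
        (S 1 3 / ?A\<^sup>2) * ((z$3 - z$4) * (z$1 - z$2))"
      by simp
  qed
qed

lemma pencil_five_converse:
  "\<exists>N. (\<forall>z. bform N z z = a * ((z$2 - z$4) * (z$1 - z$3)) + b * ((z$3 - z$4) * (z$1 - z$2))) \<and>
    (\<forall>j\<in>{1..5} - {5}. \<forall>z\<in>conf_point \<alpha> 5 j. bform N z z = 0)"
proof -
  define N :: "complex^4^4" where "N = (\<chi> i j.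
    if i = 1 \<and> j = 2 \<or> i = 3 \<and> j = 4 then a
    else if i = 1 \<and> j = 3 then b else if i = 2 \<and> j = 4 then b
    else if i = 2 \<and> j = 3 \<or> i = 1 \<and> j = 4 then - a - b else 0)"
  have N: "bform N z z = a * ((z$2 - z$4) * (z$1 - z$3)) + b * ((z$3 - z$4) * (z$1 - z$2))" for z
    by (simp add: bform_def matrix_vector_mult_def sum_4 N_def algebra_simps)
  have "bform N z z = 0" if "j \<in> {1..5} - {5}" "z \<in> conf_point \<alpha> 5 j" for j z
  proof -
    from that(2) obtain u v where z: "z = u *s base_point 5 + v *s base_point j"
      unfolding conf_point_iff by blast
    from that(1) have "j = 1 \<or> j = 2 \<or> j = 3 \<or> j = 4" by auto
    then show ?thesis unfolding N z
      by (elim disjE) (simp_all add: base_point_def axis_def)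
  qed
  with N show ?thesis by blast
qed

lemma jacobian_sextics_nonempty:
  assumes nd: "nondegenerate_plane \<alpha>"
  shows "jacobian_sextics \<alpha> \<noteq> {}"
proof -
  obtain \<phi> where \<phi>: "conic_isomorphism \<alpha> (diagm \<alpha>) \<phi>" "\<And>v. \<phi> v \<in> plane \<alpha>"
    using conic_isomorphism_exists[OF nd] by blast
  define q :: "2 \<Rightarrow> complex^4 \<Rightarrow> complex" where
    "q i z = (if i = 1 then (z$2 - z$4) * (z$1 - z$3) else (z$3 - z$4) * (z$1 - z$2))" for i z
  define f where "f i v = q i (\<phi> v)" for i v
  have "restricted_pencil \<alpha> \<phi> 5 = {(\<lambda>v. a * f 1 v + b * f 2 v) | a b. True}"
  proof (intro equalityI subsetI)
    fix F assume "F \<in> restricted_pencil \<alpha> \<phi> 5"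
    then obtain N where F: "F = (\<lambda>v. bform N (\<phi> v) (\<phi> v))"
      and N: "\<forall>j\<in>{1..5} - {5}. \<forall>z\<in>conf_point \<alpha> 5 j. bform N z z = 0"
      unfolding restricted_pencil_def by blast
    obtain a b where "\<forall>z\<in>plane \<alpha>. bform N z z = a * q 1 z + b * q 2 z"
      using pencil_five[OF nd N] by (auto simp: q_def)
    then have "F = (\<lambda>v. a * f 1 v + b * f 2 v)" using \<phi>(2) by (simp add: F f_def)
    then show "F \<in> {(\<lambda>v. a * f 1 v + b * f 2 v) | a b. True}" by blast
  next
    fix F assume "F \<in> {(\<lambda>v. a * f 1 v + b * f 2 v) | a b. True}"
    then obtain a b where F: "F = (\<lambda>v. a * f 1 v + b * f 2 v)" by blast
    obtain N where "\<forall>z. bform N z z = a * q 1 z + b * q 2 z"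
      and N: "\<forall>j\<in>{1..5} - {5}. \<forall>z\<in>conf_point \<alpha> 5 j. bform N z z = 0"
      using pencil_five_converse[of a b \<alpha>] by (auto simp: q_def)
    then have "F = (\<lambda>v. bform N (\<phi> v) (\<phi> v))" by (simp add: F f_def)
    with N show "F \<in> restricted_pencil \<alpha> \<phi> 5" unfolding restricted_pencil_def by blast
  qed
  then have "jacobian_det f \<in> jacobian_sextics \<alpha>"
    unfolding jacobian_sextics_def using von_Staudt_diagm[OF nd] \<phi>(1) by fastforce
  then show ?thesis by blast
qed

end

theory Submission
  imports Defs
begin

text \<open>
  Write \<open>x * y\<close> for the componentwise product, so that the von Staudt conic is
  \<open>lf \<alpha> (z * z) = 0\<close> in the plane \<open>lf \<alpha> z = 0\<close>. If \<open>z\<close> is on the conic, then \<open>z * z\<close> is again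
  a vector of the plane. Up to a nonzero constant, the Jacobian at \<open>z\<close> of the pencil through the
  \<open>p\<^sub>i\<^sub>j\<close> (\<open>i\<close> fixed) is the volume of \<open>z * z\<close> and two tangent vectors, hence the polar of \<open>z\<close>
  applied to \<open>z * z\<close>, that is \<open>lf \<alpha> (z * z * z)\<close>.

  At a multiple root \<open>z\<close>, with tangent vector \<open>w\<close>, the vector \<open>z * z\<close> is orthogonal to \<open>z\<close> and to
  \<open>w\<close>, hence proportional to \<open>z\<close>. So multiple roots are the nonzero idempotents of the plane, which
  are, up to sign, the sums of two frame vectors of opposite weights; these exist exactly for special
  configurations. Multiplication by \<open>z\<close> has eigenvalues \<open>0\<close> and \<open>\<lambda>\<close> only, where
  \<open>z * z = \<lambda> z\<close>, and this forces the next Taylor coefficient to be nonzero, so that the root has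
  multiplicity exactly two, as \<^const>\<open>has_double_root\<close> requires.
\<close>

subsection \<open>Tangent vectors of the von Staudt conic\<close>

lemma bform_diagm_lf: "bform (diagm \<alpha>) v w = lf \<alpha> (v * w)"
  by (simp add: bform_diagm lf_def sum_4 algebra_simps)

lemma smult_mult_vec:
  fixes x y :: "complex^'n"
  shows "(c *s x) * y = c *s (x * y)" "x * (c *s y) = c *s (x * y)"
  by (simp_all add: vec_eq_iff)

lemma lf_double: "lf \<alpha> (2 * x) = 2 * lf \<alpha> x"
  unfolding mult_2 lf_add ..

text \<open>
  The relations between the coefficients of a parametrization \<open>s\<^sup>2 a + s t d + t\<^sup>2 c\<close> of the conic.
\<close>

definition conic_basis :: "complex^4 \<Rightarrow> complex^4 \<Rightarrow> complex^4 \<Rightarrow> complex^4 \<Rightarrow> bool" where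
  "conic_basis \<alpha> a d c \<longleftrightarrow> lf \<alpha> a = 0 \<and> lf \<alpha> d = 0 \<and> lf \<alpha> c = 0 \<and>
     lf \<alpha> (a * a) = 0 \<and> lf \<alpha> (c * c) = 0 \<and> lf \<alpha> (a * d) = 0 \<and> lf \<alpha> (c * d) = 0 \<and>
     lf \<alpha> (a * c) \<noteq> 0 \<and> lf \<alpha> (d * d) = - 2 * lf \<alpha> (a * c)"

lemma conic_basis_nonzero:
  assumes "conic_basis \<alpha> a d c"
  shows "a \<noteq> 0" "d \<noteq> 0"
  using assms by (auto simp: conic_basis_def lf_def)

lemma conic_basis_spans:
  assumes "nondegenerate_plane \<alpha>" "conic_basis \<alpha> a d c" "lf \<alpha> x = 0"
  shows "\<exists>r s t. x = r *s a + s *s d + t *s c"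
  using adc_span[of \<alpha> a d c x] assms conic_basis_nonzero[OF assms(2)]
  by (simp add: conic_basis_def bform_diagm_lf plane_lf)

text \<open>The Gram matrix of \<open>a\<close>, \<open>d\<close>, \<open>c\<close> is antidiagonal,
  so pairing with a basis vector reads off a single coordinate.\<close>

lemma conic_basis_expand:
  assumes "conic_basis \<alpha> a d c"
  shows "lf \<alpha> (a * (r *s a + s *s d + t *s c)) = t * lf \<alpha> (a * c)"
    "lf \<alpha> (c * (r *s a + s *s d + t *s c)) = r * lf \<alpha> (a * c)"
    "lf \<alpha> (d * (r *s a + s *s d + t *s c)) = - 2 * s * lf \<alpha> (a * c)"
  using assms
  by (simp_all add: conic_basis_def distrib_left smult_mult_vec lf_add lf_scale
      mult.commute)

lemma conic_basis_tangent:
  assumes "nondegenerate_plane \<alpha>" "conic_basis \<alpha> a d c" "lf \<alpha> x = 0" "lf \<alpha> (a * x) = 0"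
  shows "\<exists>r s. x = r *s a + s *s d"
proof -
  obtain r s t where x: "x = r *s a + s *s d + t *s c"
    using conic_basis_spans assms by blast
  have "t = 0"
    using conic_basis_expand(1)[OF assms(2), of r s t] assms(2,4) by (simp add: x conic_basis_def)
  then show ?thesis using x by auto
qed

text \<open>A smooth conic contains no line. Completing \<open>z\<close> by an isotropic
  \<open>c\<close> and subtracting a multiple of \<open>z\<close> from \<open>u\<close> leaves a
  vector orthogonal to the whole plane, hence zero.\<close>

lemma isotropic_parallel:
  assumes nd: "nondegenerate_plane \<alpha>"
    and z: "lf \<alpha> z = 0" "z \<noteq> 0" "lf \<alpha> (z * z) = 0"
    and u: "lf \<alpha> u = 0" "lf \<alpha> (u * u) = 0" and zu: "lf \<alpha> (z * u) = 0"
  shows "\<exists>k. u = k *s z"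
proof -
  obtain x where x: "lf \<alpha> x = 0" "lf \<alpha> (z * x) \<noteq> 0"
    using smooth_diagm[OF nd] z unfolding smooth_conic_def bform_diagm_lf plane_lf by blast
  \<comment> \<open>This shift along \<open>z\<close> makes \<open>c\<close> isotropic without
    changing the pairing with \<open>z\<close>.\<close>
  define h where "h = lf \<alpha> (x * x) / (2 * lf \<alpha> (z * x))"
  define c where "c = x - h *s z"
  have h: "2 * h * lf \<alpha> (z * x) = lf \<alpha> (x * x)" using x by (simp add: h_def)
  have zc: "lf \<alpha> (z * c) = lf \<alpha> (z * x)"
    using z by (simp add: c_def right_diff_distrib smult_mult_vec lf_diff lf_scale)
  have "lf \<alpha> (c * c) = lf \<alpha> (x * x) - 2 * h * lf \<alpha> (z * x)"
    using z by (simp add: c_def right_diff_distrib left_diff_distrib smult_mult_vec lf_diff lf_scale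
        mult.commute[of x z] lf_add lf_double)
  then have cc: "lf \<alpha> (c * c) = 0" using h by simp
  \<comment> \<open>Chosen so that the remainder \<open>d\<close> is orthogonal to
    \<open>c\<close>.\<close>
  define k where "k = lf \<alpha> (u * c) / lf \<alpha> (z * c)"
  define d where "d = u - k *s z"
  have k: "k * lf \<alpha> (z * c) = lf \<alpha> (u * c)" using zc x by (simp add: k_def)
  have lc: "lf \<alpha> c = 0" using x z by (simp add: c_def lf_diff lf_scale)
  have d: "lf \<alpha> d = 0" "lf \<alpha> (z * d) = 0"
    using z u zu by (simp_all add: d_def right_diff_distrib smult_mult_vec lf_diff lf_scale)
  have cd: "lf \<alpha> (c * d) = 0"
    using k by (simp add: d_def right_diff_distrib smult_mult_vec lf_diff lf_scale
        mult.commute[of c u] mult.commute[of c z])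
  have "lf \<alpha> (u * d) = 0"
    using u zu
    by (simp add: d_def right_diff_distrib smult_mult_vec lf_diff lf_scale mult.commute[of u z])
  then have dd: "lf \<alpha> (d * d) = 0"
    using d(2) by (subst d_def) (simp add: left_diff_distrib smult_mult_vec lf_diff lf_scale)
  have "d = 0"
  proof (rule ccontr)
    assume "d \<noteq> 0"
    have "lf \<alpha> (d * y) = 0" if y: "lf \<alpha> y = 0" for y
    proof -
      obtain p q r where "y = p *s z + q *s d + r *s c"
        using adc_span[OF nd, of z d c y] d cd dd lc z zc x cc \<open>d \<noteq> 0\<close> y
        unfolding plane_lf bform_diagm_lf by auto
      then show ?thesis
        using d cd dd by (simp add: distrib_left smult_mult_vec lf_add lf_scale mult.commute)
    qed
    then show False
      using smooth_diagm[OF nd] d \<open>d \<noteq> 0\<close> unfolding smooth_conic_def bform_diagm_lf plane_lf by blast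
  qed
  then show ?thesis using d_def by auto
qed

text \<open>The hypotheses make the first two coefficients of the cubic form along the conic vanish
  at \<open>z\<close>. The first claim then bounds the multiplicity of the root by two; the second
  yields the idempotent that makes the configuration special.\<close>

lemma conic_basis_double:
  assumes nd: "nondegenerate_plane \<alpha>" and cb: "conic_basis \<alpha> z w u"
    and 0: "lf \<alpha> (z * z * z) = 0" and 1: "lf \<alpha> (z * z * w) = 0"
  shows "lf \<alpha> (z * z * u) + lf \<alpha> (z * w * w) \<noteq> 0"
    and "\<exists>e. e \<noteq> 0 \<and> lf \<alpha> e = 0 \<and> e * e = e"
proof -
  have nz: "z \<noteq> 0" "w \<noteq> 0" using conic_basis_nonzero[OF cb] by auto
  have B: "lf \<alpha> (z * z) = 0" "lf \<alpha> (z * w) = 0" "lf \<alpha> (z * u) \<noteq> 0"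
    "lf \<alpha> (w * w) = - 2 * lf \<alpha> (z * u)"
    using cb by (auto simp: conic_basis_def)
  obtain l m where zz: "z * z = l *s z + m *s w"
    using conic_basis_tangent[OF nd cb, of "z * z"] B 0 by (auto simp: mult.assoc)
  \<comment> \<open>Pairing with \<open>w\<close>, which is orthogonal to \<open>z\<close> but not
    isotropic, isolates \<open>m\<close>.\<close>
  have "lf \<alpha> (z * z * w) = m * lf \<alpha> (w * w)"
    unfolding zz using B by (simp add: distrib_right smult_mult_vec lf_add lf_scale)
  then have "m = 0" using 1 B by simp
  then have zz: "z * z = l *s z" using zz by simp
  have l: "l \<noteq> 0"
  proof
    assume "l = 0"
    then have "z * z = 0" using zz by simp
    then show False using nz(1) by (simp add: vec_eq_iff)
  qed
  define e where "e = (1 / l) *s z"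
  have "e * e = (1 / l * (1 / l) * l) *s z"
    unfolding e_def smult_mult_vec zz by (simp add: vector_smult_assoc)
  then have "e * e = e" using l by (simp add: e_def)
  moreover have "lf \<alpha> e = 0" using cb by (simp add: e_def lf_scale conic_basis_def)
  moreover have "e \<noteq> 0" using l nz by (simp add: e_def)
  ultimately show "\<exists>e. e \<noteq> 0 \<and> lf \<alpha> e = 0 \<and> e * e = e" by blast
  obtain \<mu> \<nu> where zw: "z * w = \<mu> *s z + \<nu> *s w"
    using conic_basis_tangent[OF nd cb, of "z * w"] B 1 by (auto simp: mult.assoc)
  \<comment> \<open>Multiplication by \<open>z\<close> preserves the span of \<open>z\<close> and
    \<open>w\<close>. Computing \<open>z * (z * w)\<close> in two ways and pairing with
    \<open>w\<close> shows that the second eigenvalue \<open>\<nu>\<close> is \<open>0\<close> or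
    \<open>l\<close>.\<close>
  have "z * (z * w) = l *s (z * w)" unfolding mult.assoc[symmetric] zz smult_mult_vec ..
  moreover have "z * (z * w) = (\<mu> * l) *s z + \<nu> *s (z * w)"
    by (subst zw) (simp add: distrib_left smult_mult_vec zz vector_smult_assoc)
  ultimately have "l *s (z * w) = (\<mu> * l) *s z + \<nu> *s (z * w)" by simp
  then have "lf \<alpha> (w * (l *s (z * w))) = lf \<alpha> (w * ((\<mu> * l) *s z + \<nu> *s (z * w)))" by simp
  then have "l * lf \<alpha> (w * (z * w)) = \<nu> * lf \<alpha> (w * (z * w))"
    using B by (simp add: distrib_left smult_mult_vec lf_add lf_scale mult.commute[of w z])
  moreover have n: "lf \<alpha> (w * (z * w)) = \<nu> * lf \<alpha> (w * w)"
    unfolding zw using B by (simp add: distrib_left smult_mult_vec lf_add lf_scale mult.commute[of w z])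
  ultimately have "\<nu> = 0 \<or> \<nu> = l" using B by auto
  moreover have "lf \<alpha> (z * z * u) = l * lf \<alpha> (z * u)" unfolding zz smult_mult_vec lf_scale ..
  moreover have "lf \<alpha> (z * w * w) = - 2 * \<nu> * lf \<alpha> (z * u)" using n B by (simp add: ac_simps)
  \<comment> \<open>The sum is \<open>(l - 2 * \<nu>) * lf \<alpha> (z * u)\<close>, that is,
    \<open>l\<close> or \<open>- l\<close> times a nonzero number.\<close>
  ultimately show "lf \<alpha> (z * z * u) + lf \<alpha> (z * w * w) \<noteq> 0" using B l by auto
qed

text \<open>\<open>z * z\<close> is \<open>k *s z\<close>, so both expressions reduce to pairings
  that vanish for a conic basis.\<close>

lemma conic_basis_idempotent:
  assumes nd: "nondegenerate_plane \<alpha>" and cb: "conic_basis \<alpha> z w u"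
    and e: "z = k *s e" "e * e = e"
  shows "lf \<alpha> (z * z * z) = 0" "lf \<alpha> (z * z * w) = 0"
proof -
  have "z * z = k *s z"
    unfolding e(1) by (simp add: smult_mult_vec e(2) vector_smult_assoc)
  then show "lf \<alpha> (z * z * z) = 0" "lf \<alpha> (z * z * w) = 0"
    using cb by (simp_all add: smult_mult_vec lf_scale conic_basis_def)
qed

lemma vec2_decompose:
  fixes p q v :: "complex^2"
  assumes "p$2 * q$1 - p$1 * q$2 = 1"
  shows "v = (q$1 * v$2 - q$2 * v$1) *s p + (p$2 * v$1 - p$1 * v$2) *s q"
proof -
  have "v$1 = (q$1 * v$2 - q$2 * v$1) * p$1 + (p$2 * v$1 - p$1 * v$2) * q$1"
    "v$2 = (q$1 * v$2 - q$2 * v$1) * p$2 + (p$2 * v$1 - p$1 * v$2) * q$2"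
    using assms by algebra+
  then show ?thesis
    unfolding vec_eq_iff forall_2 vector_add_component vector_smult_component by blast
qed

section \<open>Parametrizations of the conic by binary quadratic forms\<close>

lemma binary_form_2_vec:
  assumes "\<And>i. binary_form 2 (\<lambda>v. (\<phi> v :: complex^'n) $ i)"
  obtains a d c where "\<And>v. \<phi> v = (v$1)\<^sup>2 *s a + (v$1 * v$2) *s d + (v$2)\<^sup>2 *s c"
proof -
  obtain C where C: "\<And>i v. \<phi> v $ i = (\<Sum>k\<le>2. C i k * (v $ 1) ^ k * (v $ 2) ^ (2 - k))"
    using assms unfolding binary_form_def by metis
  show ?thesis
    by (rule that[of "\<chi> i. C i 2" "\<chi> i. C i 1" "\<chi> i. C i 0"])
      (simp add: vec_eq_iff C numeral_2_eq_2 algebra_simps)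
qed

text \<open>By homogeneity of degree two, the induced map on points can be computed on a single
  representative.\<close>

lemma conic_isomorphism_span:
  assumes iso: "conic_isomorphism \<alpha> M \<phi>"
  shows "vec.span (\<phi> ` vec.span {v}) = vec.span {\<phi> v}"
proof (intro equalityI vec.span_minimal vec.subspace_span)
  have "\<And>i. binary_form 2 (\<lambda>v. \<phi> v $ i)" using iso by (simp add: conic_isomorphism_def)
  from binary_form_2_vec[OF this] obtain a d c where
    \<phi>: "\<And>v. \<phi> v = (v$1)\<^sup>2 *s a + (v$1 * v$2) *s d + (v$2)\<^sup>2 *s c" by blast
  have "\<phi> (k *s v) = k\<^sup>2 *s \<phi> v" for k v
    by (simp add: \<phi> vec_eq_iff power2_eq_square algebra_simps)
  then show "\<phi> ` vec.span {v} \<subseteq> vec.span {\<phi> v}" by (auto simp: span_singleton_iff)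
  show "{\<phi> v} \<subseteq> vec.span (\<phi> ` vec.span {v})" by (simp add: vec.span_base)
qed

lemma conic_isomorphism_onto:
  assumes iso: "conic_isomorphism \<alpha> (diagm \<alpha>) \<phi>"
    and e: "e \<noteq> 0" "lf \<alpha> e = 0" "lf \<alpha> (e * e) = 0"
  obtains p k where "p \<noteq> 0" "\<phi> p = k *s e"
proof -
  have "vec.span {e} \<in> conic_points \<alpha> (diagm \<alpha>)"
    using e unfolding conic_points_def proj_points_def plane_lf bform_diagm_lf by blast
  then have "vec.span {e} \<in> (\<lambda>L. vec.span (\<phi> ` L)) ` proj_points UNIV"
    using iso unfolding conic_isomorphism_def bij_betw_def by simp
  then obtain p where p: "p \<noteq> 0" "vec.span {e} = vec.span {\<phi> p}"
    unfolding proj_points_def using conic_isomorphism_span[OF iso] by auto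
  then show ?thesis using that span_singleton_eqD[OF p(2)[symmetric]] by blast
qed

text \<open>Every \<open>\<phi> (s *s p + t *s q)\<close> is isotropic; comparing coefficients gives
  the orthogonality relations. If \<open>\<phi> p\<close> and \<open>\<phi> q\<close> were also
  orthogonal, they would be parallel, against injectivity on points.\<close>

lemma conic_isomorphism_basis:
  assumes nd: "nondegenerate_plane \<alpha>" and iso: "conic_isomorphism \<alpha> (diagm \<alpha>) \<phi>"
    and pq: "p$2 * q$1 - p$1 * q$2 \<noteq> 0"
  obtains w where "conic_basis \<alpha> (\<phi> p) w (\<phi> q)"
    and "\<And>s t. \<phi> (s *s p + t *s q) = s\<^sup>2 *s \<phi> p + (s * t) *s w + t\<^sup>2 *s \<phi> q"
proof -
  have "\<And>i. binary_form 2 (\<lambda>v. \<phi> v $ i)" using iso by (simp add: conic_isomorphism_def)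
  from binary_form_2_vec[OF this] obtain a d c where
    \<phi>: "\<And>v. \<phi> v = (v$1)\<^sup>2 *s a + (v$1 * v$2) *s d + (v$2)\<^sup>2 *s c" by blast
  have bij: "bij_betw (\<lambda>L. vec.span (\<phi> ` L)) (proj_points UNIV) (conic_points \<alpha> (diagm \<alpha>))"
    using iso by (simp add: conic_isomorphism_def)
  note img = conic_isomorphism_span[OF iso]
  \<comment> \<open>The isomorphism only controls spans; comparing \<open>\<phi> v\<close> with a
    generator \<open>x\<close> in both directions gives the conditions on \<open>\<phi> v\<close>
    itself.\<close>
  have pt: "\<phi> v \<noteq> 0 \<and> lf \<alpha> (\<phi> v) = 0 \<and> lf \<alpha> (\<phi> v * \<phi> v) = 0" if "v \<noteq> 0" for v
  proof -
    have "vec.span {\<phi> v} \<in> conic_points \<alpha> (diagm \<alpha>)"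
      using bij that unfolding bij_betw_def proj_points_def img[symmetric] by blast
    then obtain x where x: "vec.span {\<phi> v} = vec.span {x}" "x \<noteq> 0" "lf \<alpha> x = 0" "lf \<alpha> (x * x) = 0"
      unfolding conic_points_def proj_points_def plane_lf bform_diagm_lf by auto
    then obtain k where "\<phi> v = k *s x" using span_singleton_eqD by blast
    moreover obtain k' where "x = k' *s \<phi> v" using span_singleton_eqD[OF x(1)[symmetric]] by blast
    ultimately show ?thesis using x by (auto simp: smult_mult_vec lf_scale)
  qed
  have p0: "p \<noteq> 0" and q0: "q \<noteq> 0" using pq by auto
  have ind: "s *s p + t *s q \<noteq> 0" if "t \<noteq> 0" for s t
  proof
    assume "s *s p + t *s q = 0"
    then have "s * p$1 + t * q$1 = 0" "s * p$2 + t * q$2 = 0" by (simp_all add: vec_eq_iff forall_2)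
    then have "t * (p$2 * q$1 - p$1 * q$2) = 0" by algebra
    then show False using pq that by simp
  qed
  \<comment> \<open>The polarization \<open>\<phi> (p + q) - \<phi> p - \<phi> q\<close>.\<close>
  define w where "w = (2 * p$1 * q$1) *s a + (p$1 * q$2 + p$2 * q$1) *s d + (2 * p$2 * q$2) *s c"
  have ex: "\<phi> (s *s p + t *s q) = s\<^sup>2 *s \<phi> p + (s * t) *s w + t\<^sup>2 *s \<phi> q" for s t
    by (simp add: \<phi> w_def vec_eq_iff power2_eq_square algebra_simps)
  have 1: "lf \<alpha> (\<phi> p) = 0" "lf \<alpha> (\<phi> p * \<phi> p) = 0" "lf \<alpha> (\<phi> q) = 0" "lf \<alpha> (\<phi> q * \<phi> q) = 0"
    using pt p0 q0 by auto
  have 2: "lf \<alpha> w = 0" using pt[OF ind[of 1 1]] 1 unfolding ex by (simp add: lf_add lf_scale)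
  have 3: "2 * s * lf \<alpha> (\<phi> p * w) + (2 * lf \<alpha> (\<phi> p * \<phi> q) + lf \<alpha> (w * w)) * s\<^sup>2 +
      2 * s ^ 3 * lf \<alpha> (\<phi> q * w) = 0" if "s \<noteq> 0" for s
  proof -
    have "lf \<alpha> (\<phi> (1 *s p + s *s q) * \<phi> (1 *s p + s *s q)) = 0" using pt[OF ind] that by blast
    then have "s\<^sup>2 * (2 * lf \<alpha> (\<phi> p * \<phi> q)) + (s * (2 * lf \<alpha> (\<phi> p * w)) +
        (s * s * lf \<alpha> (w * w) + 2 * (s * (s\<^sup>2 * lf \<alpha> (\<phi> q * w))))) = 0"
      using 1 unfolding ex
      by (simp add: distrib_left distrib_right smult_mult_vec lf_add lf_scale lf_double
          mult.commute[of w "\<phi> p"] mult.commute[of w "\<phi> q"] mult.commute[of "\<phi> q" "\<phi> p"]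
          del: distrib_left_numeral distrib_right_numeral)
    then show ?thesis by algebra
  qed
  \<comment> \<open>Three nonzero parameters separate the coefficients of \<open>s\<close>,
    \<open>s\<^sup>2\<close> and \<open>s ^ 3\<close>.\<close>
  have 4: "lf \<alpha> (\<phi> p * w) = 0" "lf \<alpha> (\<phi> q * w) = 0" "lf \<alpha> (w * w) = - 2 * lf \<alpha> (\<phi> p * \<phi> q)"
    using 3[of 1] 3[of "-1"] 3[of 2] by (simp_all, algebra+)
  have "lf \<alpha> (\<phi> p * \<phi> q) \<noteq> 0"
  proof
    assume "lf \<alpha> (\<phi> p * \<phi> q) = 0"
    then obtain k where k: "\<phi> q = k *s \<phi> p"
      using isotropic_parallel[OF nd, of "\<phi> p" "\<phi> q"] pt p0 q0 by blast
    then have "k \<noteq> 0" using pt[OF q0] by auto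
    then have "vec.span (\<phi> ` vec.span {q}) = vec.span (\<phi> ` vec.span {p})"
      using k span_singleton_scale img by metis
    moreover have "vec.span {q} \<in> proj_points UNIV" "vec.span {p} \<in> proj_points UNIV"
      using p0 q0 by (auto simp: proj_points_def)
    ultimately have "vec.span {q} = vec.span {p}"
      using bij unfolding bij_betw_def inj_on_def by blast
    then obtain r where "q = r *s p" using span_singleton_eqD by blast
    then show False using ind[of 1 "-r"] pq by (simp add: mult.commute)
  qed
  then have "conic_basis \<alpha> (\<phi> p) w (\<phi> q)" unfolding conic_basis_def using 1 2 4 by simp
  then show ?thesis using ex that by blast
qed

subsection \<open>Binary forms and root multiplicities\<close>

lemma binary_form_add:
  assumes "binary_form d F" "binary_form d G"
  shows "binary_form d (\<lambda>v. F v + G v)"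
proof -
  obtain c e where "\<forall>v. F v = (\<Sum>k\<le>d. c k * (v $ 1) ^ k * (v $ 2) ^ (d - k))"
    "\<forall>v. G v = (\<Sum>k\<le>d. e k * (v $ 1) ^ k * (v $ 2) ^ (d - k))"
    using assms unfolding binary_form_def by blast
  then show ?thesis unfolding binary_form_def
    by (intro exI[of _ "\<lambda>k. c k + e k"]) (simp add: sum.distrib distrib_right)
qed

lemma binary_form_cmult:
  assumes "binary_form d F"
  shows "binary_form d (\<lambda>v. r * F v)"
proof -
  obtain c where "\<forall>v. F v = (\<Sum>k\<le>d. c k * (v $ 1) ^ k * (v $ 2) ^ (d - k))"
    using assms unfolding binary_form_def by blast
  then show ?thesis unfolding binary_form_def
    by (intro exI[of _ "\<lambda>k. r * c k"]) (simp add: sum_distrib_left mult.assoc)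
qed

lemma binary_form_sum:
  assumes "\<And>i. i \<in> I \<Longrightarrow> binary_form d (F i)"
  shows "binary_form d (\<lambda>v. \<Sum>i\<in>I. F i v)"
proof -
  have "binary_form d (\<lambda>v. 0)" unfolding binary_form_def by (rule exI[of _ "\<lambda>_. 0"]) simp
  then show ?thesis
    using assms by (induction I rule: infinite_finite_induct) (simp_all add: binary_form_add)
qed

lemma binary_form_times_var:
  assumes "binary_form d F"
  shows "binary_form (Suc d) (\<lambda>v. v$1 * F v)" "binary_form (Suc d) (\<lambda>v. v$2 * F v)"
proof -
  obtain c where c: "\<forall>v. F v = (\<Sum>k\<le>d. c k * (v $ 1) ^ k * (v $ 2) ^ (d - k))"
    using assms unfolding binary_form_def by blast
  show "binary_form (Suc d) (\<lambda>v. v$1 * F v)"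
    unfolding binary_form_def
    by (rule exI[of _ "\<lambda>k. if k = 0 then 0 else c (k - 1)"])
      (simp add: c sum.atMost_Suc_shift sum_distrib_left ac_simps del: sum.atMost_Suc)
  show "binary_form (Suc d) (\<lambda>v. v$2 * F v)"
    unfolding binary_form_def
    by (rule exI[of _ "\<lambda>k. if k = Suc d then 0 else c k"])
      (simp add: c sum_distrib_left Suc_diff_le ac_simps)
qed

lemma binary_form_linear_times:
  assumes "binary_form d F"
  shows "binary_form (Suc d) (\<lambda>v. (a * v$1 + b * v$2) * F v)"
  using binary_form_add[OF binary_form_cmult[OF binary_form_times_var(1)[OF assms], of a]
      binary_form_cmult[OF binary_form_times_var(2)[OF assms], of b]]
  by (simp add: distrib_right mult.assoc)

lemma binary_form_linear_powers:
  "binary_form (m + n) (\<lambda>v. (a * v$1 + b * v$2) ^ m * (a' * v$1 + b' * v$2) ^ n)"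
proof (induction m)
  case 0
  show ?case
  proof (induction n)
    case 0
    show ?case unfolding binary_form_def by (rule exI[of _ "\<lambda>_. 1"]) simp
  next
    case (Suc n)
    then show ?case using binary_form_linear_times[of n _ a' b'] by fastforce
  qed
next
  case (Suc m)
  from binary_form_linear_times[OF Suc, of a b] show ?case by (simp add: mult.assoc)
qed

text \<open>In the coordinates \<open>s\<close>, \<open>t\<close> of the basis \<open>p\<close>,
  \<open>q\<close> the linear factor of \<open>root_of_multiplicity\<close> is \<open>t\<close>, so
  the multiplicity at \<open>p\<close> is read off the lowest coefficients. That notion is exact,
  hence the condition on \<open>c 2\<close> in the first part.\<close>

lemma root_of_multiplicity_2_coeffs:
  fixes p q :: "complex^2" and c :: "nat \<Rightarrow> complex"
  assumes pq: "p$2 * q$1 - p$1 * q$2 = 1"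
    and F: "\<And>s t. F (s *s p + t *s q) = (\<Sum>k\<le>d. c k * t ^ k * s ^ (d - k))"
  shows "2 \<le> d \<Longrightarrow> c 0 = 0 \<Longrightarrow> c 1 = 0 \<Longrightarrow> c 2 \<noteq> 0 \<Longrightarrow> root_of_multiplicity d 2 F p"
    and "root_of_multiplicity d 2 F p \<Longrightarrow> c 0 = 0 \<and> c 1 = 0"
proof -
  define S where "S v = q$1 * v$2 - q$2 * v$1" for v :: "complex^2"
  define T where "T v = p$2 * v$1 - p$1 * v$2" for v :: "complex^2"
  have dec: "v = S v *s p + T v *s q" for v using vec2_decompose[OF pq, of v] by (simp add: S_def T_def)
  have Fv: "F v = (\<Sum>k\<le>d. c k * T v ^ k * S v ^ (d - k))" for v
    by (subst dec, rule F)
  have p: "S p = 1" "T p = 0" "p \<noteq> 0" using pq by (auto simp: S_def T_def mult.commute)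
  {
    assume d: "2 \<le> d" and c: "c 0 = 0" "c 1 = 0" "c 2 \<noteq> 0"
    then obtain n where n: "d = n + 2" by (metis add.commute le_Suc_ex)
    define G where "G v = (\<Sum>k\<le>n. c (k + 2) * (T v ^ k * S v ^ (n - k)))" for v
    have "binary_form n G"
    proof -
      have "binary_form n (\<lambda>v. T v ^ k * S v ^ (n - k))" if "k \<le> n" for k
        using binary_form_linear_powers[of k "n - k" "p$2" "- p$1" "- q$2" "q$1"] that
        by (simp add: T_def S_def)
      then show ?thesis
        unfolding G_def by (intro binary_form_sum binary_form_cmult) simp
    qed
    moreover have "F v = T v ^ 2 * G v" for v
      unfolding Fv n G_def
      by (simp add: sum.atMost_Suc_shift c[unfolded One_nat_def] sum_distrib_left power2_eq_square
          ac_simps del: sum.atMost_Suc)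
    moreover have "G p \<noteq> 0"
    proof -
      have "G p = (\<Sum>k\<le>n. if k = 0 then c 2 else 0)"
        unfolding G_def p by (intro sum.cong) (auto simp: numeral_2_eq_2)
      then show ?thesis using c by simp
    qed
    ultimately show "root_of_multiplicity d 2 F p"
      unfolding root_of_multiplicity_def using d p n by (auto simp: T_def)
  }
  {
    assume "root_of_multiplicity d 2 F p"
    then obtain G where d: "2 \<le> d" and G: "binary_form (d - 2) G" and FG: "\<And>v. F v = T v ^ 2 * G v"
      unfolding root_of_multiplicity_def T_def by blast
    obtain g where g: "\<And>v. G v = (\<Sum>k\<le>d-2. g k * (v $ 1) ^ k * (v $ 2) ^ (d - 2 - k))"
      using G unfolding binary_form_def by blast
    have T: "T (p + t *s q) = t" for t using pq by (simp add: T_def algebra_simps)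
    have F1: "F (p + t *s q) = (\<Sum>k\<le>d. c k * t ^ k)" for t using F[of 1 t] by simp
    have e: "(\<Sum>k\<le>d. c k * t ^ k) = t ^ 2 * G (p + t *s q)" for t
      using FG[of "p + t *s q"] unfolding F1 T .
    have c0: "c 0 = 0" using e[of 0] by (simp add: zero_power2 sum.atMost_shift)
    obtain n where n: "d = Suc (Suc n)" using d by (metis Suc_le_D numeral_2_eq_2 le_Suc_ex add_Suc)
    \<comment> \<open>The derivative at \<open>t = 0\<close> is computed twice: the polynomial gives
      \<open>c 1\<close>, the double factor gives \<open>0\<close>.\<close>
    have "((\<lambda>t. \<Sum>k\<le>d. c k * t ^ k) has_field_derivative (\<Sum>k\<le>d. c k * (of_nat k * 0 ^ (k - 1)))) (at 0)"
      by (auto intro!: derivative_eq_intros sum.cong)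
    \<comment> \<open>\<open>0 ^ (k - 1)\<close> is \<open>1\<close> for \<open>k = 0\<close> as
      well as for \<open>k = 1\<close>; the factor \<open>of_nat k\<close> removes the former
      term.\<close>
    also have "(\<Sum>k\<le>d. c k * (of_nat k * 0 ^ (k - 1))) = (\<Sum>k\<le>d. if k = 1 then c 1 else 0)"
      by (intro sum.cong) auto
    also have "\<dots> = c 1" using d by simp
    finally have 1: "((\<lambda>t. t ^ 2 * G (p + t *s q)) has_field_derivative c 1) (at 0)"
      unfolding e .
    have "(\<lambda>t. G (p + t *s q)) field_differentiable at 0"
      unfolding g vector_add_component vector_smult_component
      by (intro derivative_intros)
    then obtain D where "((\<lambda>t. G (p + t *s q)) has_field_derivative D) (at 0)"
      unfolding field_differentiable_def by blast
    then have "((\<lambda>t. t ^ 2 * G (p + t *s q)) has_field_derivative 0) (at 0)"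
      by (auto intro!: derivative_eq_intros)
    then show "c 0 = 0 \<and> c 1 = 0" using c0 DERIV_unique[OF 1] by blast
  }
qed

subsection \<open>Jacobians of pencils of conics\<close>

text \<open>
  In the variables \<^const>\<open>coord5\<close>, considered up to a common translation, the five points
  \<^const>\<open>base_point\<close> play symmetric roles. So the volume form and the pencil only involve
  differences of coordinates.
\<close>

definition vol :: "nat \<Rightarrow> nat \<Rightarrow> nat \<Rightarrow> nat \<Rightarrow> complex^4 \<Rightarrow> complex^4 \<Rightarrow> complex^4 \<Rightarrow> complex" where
  "vol j k l m u v w = (let
     u1 = coord5 u j - coord5 u m; u2 = coord5 u k - coord5 u m; u3 = coord5 u l - coord5 u m;
     v1 = coord5 v j - coord5 v m; v2 = coord5 v k - coord5 v m; v3 = coord5 v l - coord5 v m;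
     w1 = coord5 w j - coord5 w m; w2 = coord5 w k - coord5 w m; w3 = coord5 w l - coord5 w m
   in u1 * (v2 * w3 - v3 * w2) - u2 * (v1 * w3 - v3 * w1) + u3 * (v1 * w2 - v2 * w1))"

text \<open>With \<open>i\<close> the remaining index, this is the pencil through the points
  \<open>p\<^sub>i\<^sub>n\<close>, spanned by two pairs of configuration lines: in the plane,
  equality of two coordinates cuts out the axis of the corresponding point
  (\<open>span_base_point\<close>).\<close>

definition pencil_form :: "nat \<Rightarrow> nat \<Rightarrow> nat \<Rightarrow> nat \<Rightarrow> complex \<Rightarrow> complex \<Rightarrow> complex^4 \<Rightarrow> complex" where
  "pencil_form j k l m r s z =
     r * ((coord5 z k - coord5 z m) * (coord5 z j - coord5 z l)) +
     s * ((coord5 z l - coord5 z m) * (coord5 z j - coord5 z k))"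

lemma coord5_linear:
  "coord5 (x + y) i = coord5 x i + coord5 y i"
  "coord5 (x - y) i = coord5 x i - coord5 y i"
  "coord5 (c *s x) i = c * coord5 x i"
  "coord5 (x * y) i = coord5 x i * coord5 y i"
  by (simp_all add: coord5_def)

lemma vol_linear:
  "vol j k l m (u + u') v w = vol j k l m u v w + vol j k l m u' v w"
  "vol j k l m v (u + u') w = vol j k l m v u w + vol j k l m v u' w"
  "vol j k l m v w (u + u') = vol j k l m v w u + vol j k l m v w u'"
  "vol j k l m (c *s u) v w = c * vol j k l m u v w"
  "vol j k l m v (c *s u) w = c * vol j k l m v u w"
  "vol j k l m v w (c *s u) = c * vol j k l m v w u"
  by (simp_all add: vol_def Let_def coord5_linear algebra_simps)

lemma vol_same: "vol j k l m u v v = 0" "vol j k l m v u v = 0" "vol j k l m v v u = 0"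
  by (simp_all add: vol_def Let_def algebra_simps)

lemma vol_permute:
  "vol j k l m u w v = - vol j k l m u v w" "vol j k l m v u w = - vol j k l m u v w"
  "vol j k l m w u v = vol j k l m u v w" "vol j k l m v w u = vol j k l m u v w"
  "vol j k l m w v u = - vol j k l m u v w"
  by (simp_all add: vol_def Let_def algebra_simps)

lemma vol_combination:
  "vol j k l m (r1 *s a + s1 *s d + t1 *s c) (r2 *s a + s2 *s d + t2 *s c)
      (r3 *s a + s3 *s d + t3 *s c) =
    (r1 * (s2 * t3 - t2 * s3) - s1 * (r2 * t3 - t2 * r3) + t1 * (r2 * s3 - s2 * r3)) *
    vol j k l m a d c"
  by (simp add: vol_linear vol_same vol_permute[where u = a and v = d and w = c] algebra_simps)

text \<open>A difference of squares \<open>x\<^sup>2 - y\<^sup>2\<close> is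
  \<open>(x - y)\<^sup>2 + 2 * y * (x - y)\<close>. The second terms, with \<open>y\<close> equal to
  \<open>coord5 z m\<close>, contribute a multiple of \<open>vol j k l m z v w\<close>, which
  vanishes.\<close>

lemma vol_square:
  assumes "vol j k l m z v w = 0"
  shows "vol j k l m (z * z) v w = (let
     u1 = coord5 z j - coord5 z m; u2 = coord5 z k - coord5 z m; u3 = coord5 z l - coord5 z m;
     v1 = coord5 v j - coord5 v m; v2 = coord5 v k - coord5 v m; v3 = coord5 v l - coord5 v m;
     w1 = coord5 w j - coord5 w m; w2 = coord5 w k - coord5 w m; w3 = coord5 w l - coord5 w m
   in u1\<^sup>2 * (v2 * w3 - v3 * w2) - u2\<^sup>2 * (v1 * w3 - v3 * w1) + u3\<^sup>2 * (v1 * w2 - v2 * w1))"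
    (is "_ = ?R")
proof -
  have "vol j k l m (z * z) v w = ?R + 2 * coord5 z m * vol j k l m z v w"
    by (simp add: vol_def Let_def coord5_linear power2_eq_square algebra_simps)
  then show ?thesis using assms by simp
qed

text \<open>The variables are coordinate differences of the point \<open>z\<close> and two tangent
  vectors \<open>x\<close>, \<open>y\<close>; the long factors are derivatives of pencil forms. The
  two sides differ by a multiple of \<open>?D\<close>, which is zero once \<open>z\<close> is in the
  span of \<open>x\<close> and \<open>y\<close>.\<close>

lemma jacobian_identity:
  fixes x1 x2 x3 y1 y2 y3 z1 z2 z3 r s r' s' :: complex
  assumes z: "z1 * (x2 * y3 - x3 * y2) - z2 * (x1 * y3 - x3 * y1) + z3 * (x1 * y2 - x2 * y1) = 0"
    (is "?D = 0")
  shows "(r * (x2 * (z1 - z3) + z2 * (x1 - x3)) + s * (x3 * (z1 - z2) + z3 * (x1 - x2))) *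
      (r' * (y2 * (z1 - z3) + z2 * (y1 - y3)) + s' * (y3 * (z1 - z2) + z3 * (y1 - y2))) -
      (r * (y2 * (z1 - z3) + z2 * (y1 - y3)) + s * (y3 * (z1 - z2) + z3 * (y1 - y2))) *
      (r' * (x2 * (z1 - z3) + z2 * (x1 - x3)) + s' * (x3 * (z1 - z2) + z3 * (x1 - x2))) =
    2 * (r * s' - r' * s) *
      (z1\<^sup>2 * (x2 * y3 - x3 * y2) - z2\<^sup>2 * (x1 * y3 - x3 * y1) + z3\<^sup>2 * (x1 * y2 - x2 * y1))"
proof -
  have "(x2 * (z1 - z3) + z2 * (x1 - x3)) * (y3 * (z1 - z2) + z3 * (y1 - y2)) -
      (y2 * (z1 - z3) + z2 * (y1 - y3)) * (x3 * (z1 - z2) + z3 * (x1 - x2)) =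
    2 * (z1\<^sup>2 * (x2 * y3 - x3 * y2) - z2\<^sup>2 * (x1 * y3 - x3 * y1) + z3\<^sup>2 * (x1 * y2 - x2 * y1)) -
      (z1 + z2 + z3) * ?D"
    by (simp add: power2_eq_square algebra_simps)
  then have "(x2 * (z1 - z3) + z2 * (x1 - x3)) * (y3 * (z1 - z2) + z3 * (y1 - y2)) -
      (y2 * (z1 - z3) + z2 * (y1 - y3)) * (x3 * (z1 - z2) + z3 * (x1 - x2)) =
    2 * (z1\<^sup>2 * (x2 * y3 - x3 * y2) - z2\<^sup>2 * (x1 * y3 - x3 * y1) + z3\<^sup>2 * (x1 * y2 - x2 * y1))"
    (is "?P * ?Q - ?R * ?S = 2 * ?V")
    unfolding z by simp
  then have *: "(r * s' - r' * s) * (?P * ?Q - ?R * ?S) = (r * s' - r' * s) * (2 * ?V)"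
    by (rule arg_cong)
  have e: "(r * P + s * S) * (r' * R + s' * Q) - (r * R + s * Q) * (r' * P + s' * S) =
      (r * s' - r' * s) * (P * Q - R * S)" for P Q R S
    by (simp add: algebra_simps)
  show ?thesis unfolding e * by (simp only: mult.assoc mult.left_commute)
qed

lemma DERIV_pencil_form:
  assumes "\<And>i. ((\<lambda>t. coord5 (\<psi> t) i) has_field_derivative coord5 w i) (at 0)" "\<psi> 0 = z"
  shows "deriv (\<lambda>t. pencil_form j k l m r s (\<psi> t)) 0 =
    r * ((coord5 w k - coord5 w m) * (coord5 z j - coord5 z l) +
         (coord5 z k - coord5 z m) * (coord5 w j - coord5 w l)) +
    s * ((coord5 w l - coord5 w m) * (coord5 z j - coord5 z k) +
         (coord5 z l - coord5 z m) * (coord5 w j - coord5 w k))"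
  unfolding pencil_form_def
  by (rule DERIV_imp_deriv)
    (auto intro!: derivative_eq_intros assms(1) simp: assms(2) algebra_simps)

lemma jacobian_det_pencil_form:
  fixes a d c :: "complex^4" and v :: "complex^2"
  assumes \<phi>: "\<And>v. \<phi> v = (v$1)\<^sup>2 *s a + (v$1 * v$2) *s d + (v$2)\<^sup>2 *s c"
    and f: "\<And>i v. f i v = pencil_form j k l m (r i) (s i) (\<phi> v)"
  shows "jacobian_det f v = 2 * (r 1 * s 2 - r 2 * s 1) *
    vol j k l m (\<phi> v * \<phi> v) ((2 * v$1) *s a + v$2 *s d) (v$1 *s d + (2 * v$2) *s c)"
proof -
  define X where "X = (2 * v$1) *s a + v$2 *s d"
  define Y where "Y = v$1 *s d + (2 * v$2) *s c"
  let ?z = "\<phi> v"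
  have X: "((\<lambda>t. coord5 (\<phi> (v + t *s axis 1 1)) i) has_field_derivative coord5 X i) (at 0)" for i
    unfolding \<phi> X_def coord5_linear
    by (auto intro!: derivative_eq_intros simp: axis_def)
  have Y: "((\<lambda>t. coord5 (\<phi> (v + t *s axis 2 1)) i) has_field_derivative coord5 Y i) (at 0)" for i
    unfolding \<phi> Y_def coord5_linear
    by (auto intro!: derivative_eq_intros simp: axis_def)
  have d: "partial_deriv 1 (f i) v = r i *
        ((coord5 X k - coord5 X m) * (coord5 ?z j - coord5 ?z l) +
         (coord5 ?z k - coord5 ?z m) * (coord5 X j - coord5 X l)) +
    s i * ((coord5 X l - coord5 X m) * (coord5 ?z j - coord5 ?z k) +
         (coord5 ?z l - coord5 ?z m) * (coord5 X j - coord5 X k))"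
    "partial_deriv 2 (f i) v = r i *
        ((coord5 Y k - coord5 Y m) * (coord5 ?z j - coord5 ?z l) +
         (coord5 ?z k - coord5 ?z m) * (coord5 Y j - coord5 Y l)) +
    s i * ((coord5 Y l - coord5 Y m) * (coord5 ?z j - coord5 ?z k) +
         (coord5 ?z l - coord5 ?z m) * (coord5 Y j - coord5 Y k))" for i
    unfolding partial_deriv_def f
    by (rule DERIV_pencil_form[OF X], simp) (rule DERIV_pencil_form[OF Y], simp)
  \<comment> \<open>Euler's relation: twice the point is a combination of the two partial
    derivatives of \<open>\<phi>\<close>.\<close>
  have zXY: "vol j k l m ?z X Y = 0"
  proof -
    have "2 *s ?z = v$1 *s X + v$2 *s Y"
      by (simp add: \<phi> X_def Y_def vec_eq_iff power2_eq_square algebra_simps)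
    then have "vol j k l m (2 *s ?z) X Y = vol j k l m (v$1 *s X + v$2 *s Y) X Y" by simp
    then show ?thesis by (simp add: vol_linear vol_same del: vector_smult_assoc)
  qed
  show ?thesis
    unfolding jacobian_det_def det_2 X_def[symmetric] Y_def[symmetric] vol_square[OF zXY] Let_def
    using jacobian_identity[OF zXY[unfolded vol_def Let_def], of "r 1" "s 1" "r 2" "s 2"]
    by (simp add: d)
qed

text \<open>The tangent line at a point of the conic is its polar. So the volume of \<open>v\<close>
  with two tangent vectors is proportional to the pairing of \<open>v\<close> with the point;
  coordinates give the factor.\<close>

lemma vol_conic_basis:
  assumes nd: "nondegenerate_plane \<alpha>" and cb: "conic_basis \<alpha> a d c" and v: "lf \<alpha> v = 0"
  shows "lf \<alpha> (a * c) * vol j k l m v ((2 * x) *s a + y *s d) (x *s d + (2 * y) *s c) =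
    2 * vol j k l m a d c * lf \<alpha> ((x\<^sup>2 *s a + (x * y) *s d + y\<^sup>2 *s c) * v)"
proof -
  obtain r s t where v: "v = r *s a + s *s d + t *s c"
    using conic_basis_spans[OF nd cb v] by blast
  have "lf \<alpha> ((x\<^sup>2 *s a + (x * y) *s d + y\<^sup>2 *s c) * v) =
      x\<^sup>2 * lf \<alpha> (a * v) + x * y * lf \<alpha> (d * v) + y\<^sup>2 * lf \<alpha> (c * v)"
    by (simp add: distrib_right smult_mult_vec lf_add lf_scale)
  also have "\<dots> = (x\<^sup>2 * t - 2 * x * y * s + y\<^sup>2 * r) * lf \<alpha> (a * c)"
    unfolding v conic_basis_expand[OF cb] by (simp add: algebra_simps)
  finally have 1: "lf \<alpha> ((x\<^sup>2 *s a + (x * y) *s d + y\<^sup>2 *s c) * v) =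
    (x\<^sup>2 * t - 2 * x * y * s + y\<^sup>2 * r) * lf \<alpha> (a * c)" .
  have "vol j k l m v ((2 * x) *s a + y *s d) (x *s d + (2 * y) *s c) =
      2 * (x\<^sup>2 * t - 2 * x * y * s + y\<^sup>2 * r) * vol j k l m a d c"
    using vol_combination[of j k l m r a s d t c "2 * x" y 0 0 x "2 * y"]
    by (simp add: v power2_eq_square algebra_simps)
  then show ?thesis unfolding 1 by simp
qed

subsection \<open>The Desargues configuration in five homogeneous coordinates\<close>

text \<open>
  The sign makes the five frame vectors, and hence the five weights, sum to zero.
\<close>

definition frame_vec :: "nat \<Rightarrow> complex^4" where
  "frame_vec k = (if k = 5 then - 1 else base_point k)"

definition weight :: "complex^4 \<Rightarrow> nat \<Rightarrow> complex" where
  "weight \<alpha> k = lf \<alpha> (frame_vec k)"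

text \<open>A generator of \<open>p\<^sub>i\<^sub>j\<close>, antisymmetric in \<open>i\<close> and
  \<open>j\<close>. With the signs of \<open>frame_vec\<close>, the generators with a common
  \<open>i\<close> sum to zero.\<close>

definition vertex :: "complex^4 \<Rightarrow> nat \<Rightarrow> nat \<Rightarrow> complex^4" where
  "vertex \<alpha> i j = weight \<alpha> j *s frame_vec i - weight \<alpha> i *s frame_vec j"

lemma coord5_frame_vec:
  assumes "i \<in> {1..5}" "k \<in> {1..5}"
  shows "coord5 (frame_vec k) i = (if i = k then 1 else 0) - (if k = 5 then 1 else 0)"
  using assms unfolding nat_15
  by (elim disjE) (simp_all add: coord5_def frame_vec_def base_point_def axis_def)

lemma weight_eq:
  "weight \<alpha> 1 = \<alpha>$1" "weight \<alpha> (Suc 0) = \<alpha>$1" "weight \<alpha> 2 = \<alpha>$2" "weight \<alpha> 3 = \<alpha>$3"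
  "weight \<alpha> 4 = \<alpha>$4" "weight \<alpha> 5 = - (\<alpha>$1 + \<alpha>$2 + \<alpha>$3 + \<alpha>$4)"
  by (simp_all add: weight_def frame_vec_def base_point_def lf_def sum_4 axis_def)

lemma weight_nonzero:
  assumes "nondegenerate_plane \<alpha>" "k \<in> {1..5}"
  shows "weight \<alpha> k \<noteq> 0"
proof -
  have "lf \<alpha> (base_point k) \<noteq> 0"
    using assms by (auto simp: nondegenerate_plane_def plane_lf)
  moreover have "lf \<alpha> (- x) = - lf \<alpha> x" for x by (simp add: lf_def sum_negf)
  ultimately show ?thesis
    by (auto simp: weight_def frame_vec_def base_point_def split: if_splits)
qed

lemma sum_perm_15:
  assumes "{i, j, k, l, m} = {1..5::nat}"
  shows "sum f {1..5} = f i + f j + f k + f l + (f m :: 'a::comm_monoid_add)"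
proof -
  have "length [i, j, k, l, m] = card (set [i, j, k, l, m])" using assms by simp
  then have "distinct [i, j, k, l, m]" by (metis card_distinct)
  then show ?thesis unfolding assms[symmetric] by (simp add: add.assoc)
qed

lemma perm_15_distinct:
  assumes "{i, j, k, l, m} = {1..5::nat}"
  shows "i \<noteq> j" "i \<noteq> k" "i \<noteq> l" "i \<noteq> m" "j \<noteq> k" "j \<noteq> l" "j \<noteq> m" "k \<noteq> l" "k \<noteq> m" "l \<noteq> m"
    "i \<in> {1..5}" "j \<in> {1..5}" "k \<in> {1..5}" "l \<in> {1..5}" "m \<in> {1..5}"
proof -
  have "length [i, j, k, l, m] = card (set [i, j, k, l, m])" using assms by simp
  then have "distinct [i, j, k, l, m]" by (metis card_distinct)
  then show "i \<noteq> j" "i \<noteq> k" "i \<noteq> l" "i \<noteq> m" "j \<noteq> k" "j \<noteq> l" "j \<noteq> m" "k \<noteq> l" "k \<noteq> m" "l \<noteq> m"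
    by auto
  show "i \<in> {1..5}" "j \<in> {1..5}" "k \<in> {1..5}" "l \<in> {1..5}" "m \<in> {1..5}" using assms by auto
qed

lemma perm_15_exists:
  assumes "i \<in> {1..5::nat}" "j \<in> {1..5}" "i \<noteq> j"
  obtains k l m where "{i, j, k, l, m} = {1..5}"
proof -
  have "card ({1..5} - {i, j}) = 3" using assms by (simp add: card_Diff_subset)
  then obtain k l m where "{1..5} - {i, j} = {k, l, m}" unfolding card_3_iff by blast
  then have "{i, j, k, l, m} = {1..5}" using assms by blast
  then show ?thesis by (rule that)
qed

lemma frame_vec_expand: "z = (\<Sum>n\<in>{1..5}. coord5 z n *s frame_vec n)"
  unfolding set_15
  by (simp add: vec_eq_iff forall_4 frame_vec_def base_point_def coord5_def axis_def)

lemma lf_weight: "lf \<alpha> z = (\<Sum>n\<in>{1..5}. weight \<alpha> n * coord5 z n)"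
  unfolding set_15 by (simp add: weight_eq lf_def sum_4 coord5_def)

lemma sum_frame_vec: "(\<Sum>n\<in>{1..5}. frame_vec n) = 0"
  unfolding set_15 by (simp add: vec_eq_iff forall_4 frame_vec_def base_point_def axis_def)

lemma sum_weight: "(\<Sum>n\<in>{1..5}. weight \<alpha> n) = 0"
  unfolding set_15 by (simp add: weight_eq)

text \<open>Up to a common translation, the coordinates of \<open>vertex \<alpha> i j\<close> vanish
  except at \<open>i\<close> and \<open>j\<close>, the latter being
  \<open>- weight \<alpha> i\<close>. Differences with coordinate \<open>m\<close> therefore give
  the coefficients.\<close>

lemma plane_expand:
  assumes nd: "nondegenerate_plane \<alpha>" and perm: "{i, j, k, l, m} = {1..5}" and z: "lf \<alpha> z = 0"
  shows "z = ((coord5 z m - coord5 z j) / weight \<alpha> i) *s vertex \<alpha> i j +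
    ((coord5 z m - coord5 z k) / weight \<alpha> i) *s vertex \<alpha> i k +
    ((coord5 z m - coord5 z l) / weight \<alpha> i) *s vertex \<alpha> i l" (is "z = ?R")
proof -
  let ?w = "weight \<alpha>" and ?E = frame_vec and ?c = "coord5 z"
  have wi: "?w i \<noteq> 0" using weight_nonzero[OF nd] perm_15_distinct[OF perm] by blast
  have "?w i + ?w j + ?w k + ?w l + ?w m = 0"
    using sum_weight[of \<alpha>] unfolding sum_perm_15[OF perm] .
  then have wm: "?w m = - (?w i + ?w j + ?w k + ?w l)" unfolding eq_neg_iff_add_eq_0 by (simp only: ac_simps)
  have w: "?w i * ?c i + ?w j * ?c j + ?w k * ?c k + ?w l * ?c l + ?w m * ?c m = 0"
    using z unfolding lf_weight sum_perm_15[OF perm] .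
  have "?E i + ?E j + ?E k + ?E l + ?E m = 0"
    using sum_frame_vec unfolding sum_perm_15[OF perm] .
  then have Em: "?E m = - (?E i + ?E j + ?E k + ?E l)"
    unfolding eq_neg_iff_add_eq_0 by (simp only: ac_simps)
  have zz: "z = ?c i *s ?E i + ?c j *s ?E j + ?c k *s ?E k + ?c l *s ?E l + ?c m *s ?E m"
    using frame_vec_expand[of z] unfolding sum_perm_15[OF perm] .
  have "?w i *s ?R = (?c m - ?c j) *s vertex \<alpha> i j + (?c m - ?c k) *s vertex \<alpha> i k +
      (?c m - ?c l) *s vertex \<alpha> i l"
    using wi by (simp add: vector_add_ldistrib vector_smult_assoc)
  also have "\<dots> = (?w j * (?c m - ?c j) + ?w k * (?c m - ?c k) + ?w l * (?c m - ?c l)) *s ?E i -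
      ?w i *s ((?c m - ?c j) *s ?E j + (?c m - ?c k) *s ?E k + (?c m - ?c l) *s ?E l)"
    by (simp add: vertex_def vec_eq_iff algebra_simps)
  also have "?w j * (?c m - ?c j) + ?w k * (?c m - ?c k) + ?w l * (?c m - ?c l) =
      ?w i * (?c i - ?c m)"
    using w unfolding wm by algebra
  also have "(?w i * (?c i - ?c m)) *s ?E i -
      ?w i *s ((?c m - ?c j) *s ?E j + (?c m - ?c k) *s ?E k + (?c m - ?c l) *s ?E l) =
      ?w i *s (?c i *s ?E i + ?c j *s ?E j + ?c k *s ?E k + ?c l *s ?E l + ?c m *s ?E m)"
    unfolding Em by (simp add: vec_eq_iff algebra_simps)
  also have "\<dots> = ?w i *s z" using zz by simp
  finally show ?thesis using wi unfolding vector_mul_lcancel by simp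
qed

lemma conf_point_vertex:
  assumes nd: "nondegenerate_plane \<alpha>" and ij: "i \<in> {1..5}" "j \<in> {1..5}"
  shows "z \<in> conf_point \<alpha> i j \<longleftrightarrow> (\<exists>t. z = t *s vertex \<alpha> i j)"
proof -
  \<comment> \<open>These signs relate \<open>base_point\<close> to \<open>frame_vec\<close>, which
    is negated at index \<open>5\<close>.\<close>
  define \<epsilon> :: "nat \<Rightarrow> complex" where "\<epsilon> n = (if n = 5 then - 1 else 1)" for n
  have \<epsilon>: "\<epsilon> n * \<epsilon> n = 1" "\<epsilon> n * (\<epsilon> n * x) = x" for n x by (simp_all add: \<epsilon>_def)
  have b: "base_point n = \<epsilon> n *s frame_vec n" for n
    by (auto simp: \<epsilon>_def frame_vec_def base_point_def vec_eq_iff)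
  have w: "lf \<alpha> (base_point n) = \<epsilon> n * weight \<alpha> n" for n
    by (simp add: b lf_scale weight_def)
  have wi: "weight \<alpha> i \<noteq> 0" using weight_nonzero[OF nd] ij by blast
  show ?thesis unfolding conf_point_iff
  proof safe
    fix a c assume "a * lf \<alpha> (base_point i) + c * lf \<alpha> (base_point j) = 0"
    then have "a * \<epsilon> i * weight \<alpha> i = - (c * \<epsilon> j) * weight \<alpha> j"
      by (simp add: w eq_neg_iff_add_eq_0 mult.assoc)
    then have a: "a * \<epsilon> i = - (c * \<epsilon> j / weight \<alpha> i) * weight \<alpha> j"
      using wi by (simp add: field_simps)
    have "a *s base_point i + c *s base_point j = (a * \<epsilon> i) *s frame_vec i + (c * \<epsilon> j) *s frame_vec j"
      by (simp add: b)
    also have "\<dots> = - (c * \<epsilon> j / weight \<alpha> i) *s vertex \<alpha> i j"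
      unfolding a using wi by (simp add: vertex_def vec_eq_iff field_simps)
    finally show "\<exists>t. a *s base_point i + c *s base_point j = t *s vertex \<alpha> i j" ..
  next
    fix t
    have "t *s vertex \<alpha> i j = (t * weight \<alpha> j * \<epsilon> i) *s base_point i +
        (- t * weight \<alpha> i * \<epsilon> j) *s base_point j"
      by (simp add: \<epsilon> b vertex_def vec_eq_iff algebra_simps)
    moreover have "(t * weight \<alpha> j * \<epsilon> i) * lf \<alpha> (base_point i) +
        (- t * weight \<alpha> i * \<epsilon> j) * lf \<alpha> (base_point j) = 0"
      unfolding w by (simp add: \<epsilon> algebra_simps)
    ultimately show "\<exists>a b. t *s vertex \<alpha> i j = a *s base_point i + b *s base_point j \<and>
        a * lf \<alpha> (base_point i) + b * lf \<alpha> (base_point j) = 0" by blast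
  qed
qed

lemma lf_vertex: "lf \<alpha> (vertex \<alpha> i j) = 0"
  by (simp add: vertex_def lf_diff lf_scale weight_def[symmetric])

lemma coord5_vertex_diff:
  assumes "i \<in> {1..5}" "j \<in> {1..5}" "n \<in> {1..5}" "n' \<in> {1..5}"
  shows "coord5 (vertex \<alpha> i j) n - coord5 (vertex \<alpha> i j) n' =
    weight \<alpha> j * ((if n = i then 1 else 0) - (if n' = i then 1 else 0)) -
    weight \<alpha> i * ((if n = j then 1 else 0) - (if n' = j then 1 else 0))"
  using assms by (simp add: vertex_def coord5_linear coord5_frame_vec algebra_simps)

text \<open>In coordinates relative to \<open>m\<close> the three vectors are
  \<open>- weight \<alpha> i\<close> times the unit vectors. So the volume form is not zero on the
  plane, which later makes the constant of the Jacobian nonzero.\<close>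

lemma vol_vertices_nonzero:
  assumes nd: "nondegenerate_plane \<alpha>" and perm: "{i, j, k, l, m} = {1..5}"
  shows "vol j k l m (vertex \<alpha> i j) (vertex \<alpha> i k) (vertex \<alpha> i l) \<noteq> 0"
proof -
  note d = perm_15_distinct[OF perm]
  have "vol j k l m (vertex \<alpha> i j) (vertex \<alpha> i k) (vertex \<alpha> i l) = - (weight \<alpha> i ^ 3)"
    using d d(1-10)[THEN not_sym]
    by (simp add: vol_def Let_def coord5_vertex_diff power3_eq_cube del: atLeastAtMost_iff)
  then show ?thesis using weight_nonzero[OF nd d(11)] by simp
qed

section \<open>The pencil of conics through four configuration points\<close>

text \<open>In a basis of three of the generators, vanishing at these three points leaves only mixed
  terms. Vanishing at the fourth, minus their sum, gives one linear relation, so two free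
  coefficients remain.\<close>

lemma pencil_form_of_vanishing:
  assumes nd: "nondegenerate_plane \<alpha>" and perm: "{i, j, k, l, m} = {1..5}"
    and N: "\<forall>n\<in>{1..5} - {i}. \<forall>z\<in>conf_point \<alpha> i n. bform N z z = 0"
  shows "\<exists>r s. \<forall>z. lf \<alpha> z = 0 \<longrightarrow> bform N z z = pencil_form j k l m r s z"
proof -
  note d = perm_15_distinct[OF perm]
  let ?w = "weight \<alpha>"
  have wi: "?w i \<noteq> 0" using weight_nonzero[OF nd d(11)] .
  define y where "y = vertex \<alpha> i"
  have y: "bform N (y n) (y n) = 0" if "n \<in> {1..5}" "n \<noteq> i" for n
  proof -
    have "y n \<in> conf_point \<alpha> i n"
      unfolding conf_point_vertex[OF nd d(11) that(1)] y_def by (rule exI[of _ 1]) simp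
    then show ?thesis using N that by blast
  qed
  have yy: "bform N (y j) (y j) = 0" "bform N (y k) (y k) = 0" "bform N (y l) (y l) = 0"
    "bform N (y m) (y m) = 0"
    using d by (auto intro!: y simp del: atLeastAtMost_iff)
  define S where "S a b = bform N (y a) (y b) + bform N (y b) (y a)" for a b
  have z: "z = ((coord5 z m - coord5 z j) / ?w i) *s y j + ((coord5 z m - coord5 z k) / ?w i) *s y k +
      ((coord5 z m - coord5 z l) / ?w i) *s y l" if "lf \<alpha> z = 0" for z
    using plane_expand[OF nd perm that] unfolding y_def .
  have ym: "y m = (- 1) *s (y j + y k + y l)"
  proof -
    have "coord5 (y m) m - coord5 (y m) n = - ?w i" if "n = j \<or> n = k \<or> n = l" for n
      using that d d(1-10)[THEN not_sym] unfolding y_def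
      by (elim disjE) (simp_all add: coord5_vertex_diff del: atLeastAtMost_iff)
    then show ?thesis using z[of "y m"] wi by (simp add: y_def lf_vertex vec_eq_iff)
  qed
  have "bform N (y m) (y m) = S j k + S j l + S k l"
    unfolding ym bform_linear using yy by (simp add: S_def)
  then have S: "S k l = - S j k - S j l" using yy by (simp add: algebra_simps eq_neg_iff_add_eq_0)
  show ?thesis
  proof (intro exI allI impI)
    fix z assume lz: "lf \<alpha> z = 0"
    define x where "x n = (coord5 z m - coord5 z n) / ?w i" for n
    have zz: "z = x j *s y j + x k *s y k + x l *s y l" using z[OF lz] unfolding x_def .
    have "bform N z z = x j * x k * S j k + x j * x l * S j l + x k * x l * S k l"
      unfolding zz using yy by (simp add: bform_linear S_def algebra_simps)
    also have "\<dots> = S j k * (x k * (x j - x l)) + S j l * (x l * (x j - x k))"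
      unfolding S by (simp add: algebra_simps)
    also have "\<dots> = pencil_form j k l m (S j k / (?w i)\<^sup>2) (S j l / (?w i)\<^sup>2) z"
      using wi by (simp add: x_def pencil_form_def field_simps power2_eq_square)
    finally show "bform N z z = pencil_form j k l m (S j k / (?w i)\<^sup>2) (S j l / (?w i)\<^sup>2) z" .
  qed
qed

lemma bform_product: "bform (\<chi> i j. p $ i * q $ j) z z = lf p z * lf q z"
  by (simp add: bform_def matrix_vector_mult_def lf_def sum_4 algebra_simps)

lemma coord5_lf: "coord5 z n = lf (if n = 5 then 0 else axis (of_nat n) 1) z"
proof -
  have "lf (axis x 1) z = z $ x" for x :: 4
    using exhaust_4[of x] by (auto simp: lf_def sum_4 axis_def)
  then show ?thesis by (simp add: coord5_def) (simp add: lf_def)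
qed

lemma bform_add_matrix: "bform (M + N) v w = bform M v w + bform N v w"
  by (simp add: bform_def matrix_vector_mult_add_rdistrib sum.distrib distrib_left)

lemma lf_diff_left: "lf (p - q) z = lf p z - lf q z"
  by (simp add: lf_def left_diff_distrib sum_subtractf)

lemma lf_scale_left: "lf (c *s p) z = c * lf p z"
  by (simp add: lf_def sum_distrib_left mult.assoc)

text \<open>Each \<open>p\<^sub>i\<^sub>n\<close> lies on a line of each pair: up to translation its
  only nonzero coordinate among \<open>j\<close>, \<open>k\<close>, \<open>l\<close>,
  \<open>m\<close> is the \<open>n\<close>-th, and the two factors of a product involve disjoint
  indices.\<close>

lemma pencil_form_vanishing:
  assumes nd: "nondegenerate_plane \<alpha>" and perm: "{i, j, k, l, m} = {1..5}"
  shows "\<exists>N. (\<forall>z. bform N z z = pencil_form j k l m r s z) \<and>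
    (\<forall>n\<in>{1..5} - {i}. \<forall>z\<in>conf_point \<alpha> i n. bform N z z = 0)"
proof -
  note d = perm_15_distinct[OF perm]
  define K :: "nat \<Rightarrow> complex^4" where "K n = (if n = 5 then 0 else axis (of_nat n) 1)" for n
  define N :: "complex^4^4" where
    "N = (\<chi> a b. (r *s (K k - K m)) $ a * (K j - K l) $ b) +
      (\<chi> a b. (s *s (K l - K m)) $ a * (K j - K k) $ b)"
  have N: "bform N z z = pencil_form j k l m r s z" for z
    unfolding N_def bform_add_matrix bform_product
    by (simp add: lf_scale_left lf_diff_left coord5_lf[of z, folded K_def] pencil_form_def algebra_simps)
  have "bform N z z = 0" if n: "n \<in> {1..5} - {i}" and z: "z \<in> conf_point \<alpha> i n" for n z
  proof -
    obtain t where t: "z = t *s vertex \<alpha> i n"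
      using z n conf_point_vertex[OF nd d(11)] by blast
    have "n = j \<or> n = k \<or> n = l \<or> n = m" using n unfolding perm[symmetric] by blast
    moreover have D: "coord5 z a - coord5 z b =
        t * (- (weight \<alpha> i * ((if a = n then 1 else 0) - (if b = n then 1 else 0))))"
      if "a \<in> {j, k, l, m}" "b \<in> {j, k, l, m}" for a b
    proof -
      have "coord5 z a - coord5 z b = t * (coord5 (vertex \<alpha> i n) a - coord5 (vertex \<alpha> i n) b)"
        by (simp add: t coord5_linear right_diff_distrib)
      also have "coord5 (vertex \<alpha> i n) a - coord5 (vertex \<alpha> i n) b =
          - (weight \<alpha> i * ((if a = n then 1 else 0) - (if b = n then 1 else 0)))"
        using that d n by (subst coord5_vertex_diff) auto
      finally show ?thesis .
    qed
    ultimately show ?thesis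
      unfolding N pencil_form_def using d by (elim disjE) (simp_all add: D del: atLeastAtMost_iff)
  qed
  with N show ?thesis by blast
qed

section \<open>Uniqueness of the von Staudt conic\<close>

text \<open>Reduces an arbitrary von Staudt conic to \<open>diagm \<alpha>\<close>. Equal polars of
  the points \<open>p\<^sub>5\<^sub>n\<close> make the two forms, paired with \<open>y n\<close>,
  proportional; symmetry and nonzero mixed pairings make the three ratios agree.\<close>

lemma von_Staudt_conic_unique:
  assumes nd: "nondegenerate_plane \<alpha>" and M: "von_Staudt_conic \<alpha> M"
  obtains c where "c \<noteq> 0" "\<And>v w. lf \<alpha> v = 0 \<Longrightarrow> lf \<alpha> w = 0 \<Longrightarrow> bform M v w = c * lf \<alpha> (v * w)"
proof -
  define y where "y = vertex \<alpha> 5"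
  have ly: "lf \<alpha> (y n) = 0" for n unfolding y_def by (rule lf_vertex)
  have sym: "bform M v w = bform M w v" for v w
  proof -
    have "transpose M = M" using M by (simp add: von_Staudt_conic_def)
    moreover have "transpose M $ b $ a = M $ a $ b" for a b by (simp add: transpose_def)
    ultimately have "M $ a $ b = M $ b $ a" for a b by metis
    from this[of 1 2] this[of 1 3] this[of 1 4] this[of 2 3] this[of 2 4] this[of 3 4]
    show ?thesis by (simp add: bform_def matrix_vector_mult_def sum_4 algebra_simps)
  qed
  have same_kernel: "bform M (y n) w = 0 \<longleftrightarrow> lf \<alpha> (y n * w) = 0"
    if n: "n \<in> {1,2,3}" and w: "lf \<alpha> w = 0" for n w
  proof -
    have n': "n \<in> {1..5}" "5 \<in> {1..5::nat}" "5 \<noteq> n" using n by auto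
    obtain k l m where perm: "{5, n, k, l, m} = {1..5}" using perm_15_exists[OF n'(2,1,3)] .
    have "polar \<alpha> M (conf_point \<alpha> 5 n) = polar \<alpha> (diagm \<alpha>) (conf_point \<alpha> 5 n)"
      using M von_Staudt_diagm[OF nd] perm unfolding von_Staudt_conic_def by metis
    then have "(\<forall>v\<in>conf_point \<alpha> 5 n. bform M v w = 0) \<longleftrightarrow>
        (\<forall>v\<in>conf_point \<alpha> 5 n. bform (diagm \<alpha>) v w = 0)"
      using w unfolding polar_def plane_lf by blast
    moreover have "(\<forall>v\<in>conf_point \<alpha> 5 n. bform M' v w = 0) \<longleftrightarrow> bform M' (y n) w = 0" for M'
    proof -
      have "(\<forall>v\<in>conf_point \<alpha> 5 n. bform M' v w = 0) \<longleftrightarrow> (\<forall>t. bform M' (t *s y n) w = 0)"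
        by (auto simp: conf_point_vertex[OF nd n'(2,1)] y_def)
      then show ?thesis by (metis bform_scale_left mult_zero_right vector_smult_lid)
    qed
    ultimately show ?thesis unfolding bform_diagm_lf[symmetric] by simp
  qed
  have yy: "lf \<alpha> (y a * y b) \<noteq> 0" if "a \<in> {1,2,3}" "b \<in> {1,2,3}" "a \<noteq> b" for a b
  proof -
    have "frame_vec a * frame_vec b = 0"
      using that by (auto simp: frame_vec_def base_point_def vec_eq_iff axis_def)
    moreover have "frame_vec 5 * x = - x" "x * frame_vec 5 = - x" for x
      by (simp_all add: frame_vec_def)
    ultimately have "y a * y b = (- (weight \<alpha> a * weight \<alpha> b)) *s frame_vec 5 +
        (weight \<alpha> 5 * weight \<alpha> a) *s frame_vec b + (weight \<alpha> 5 * weight \<alpha> b) *s frame_vec a"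
      unfolding y_def vertex_def
      by (simp add: right_diff_distrib left_diff_distrib smult_mult_vec)
        (simp add: vec_eq_iff algebra_simps)
    then have "lf \<alpha> (y a * y b) = weight \<alpha> 5 * weight \<alpha> a * weight \<alpha> b"
      by (simp add: lf_add lf_diff lf_scale weight_def[symmetric])
    then show ?thesis using that weight_nonzero[OF nd] by auto
  qed
  have proportional: "bform M (y a) w * lf \<alpha> (y a * y b) = bform M (y a) (y b) * lf \<alpha> (y a * w)"
    if "a \<in> {1,2,3}" "b \<in> {1,2,3}" "a \<noteq> b" "lf \<alpha> w = 0" for a b w
  proof -
    \<comment> \<open>The combination of \<open>w\<close> and \<open>y b\<close> killed by the
      diagonal form paired with \<open>y a\<close>.\<close>
    define x where "x = lf \<alpha> (y a * y b) *s w - lf \<alpha> (y a * w) *s y b"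
    have "lf \<alpha> x = 0" using that ly by (simp add: x_def lf_diff lf_scale)
    moreover have "lf \<alpha> (y a * x) = 0"
      by (simp add: x_def right_diff_distrib smult_mult_vec lf_diff lf_scale)
    ultimately have "bform M (y a) x = 0" using same_kernel that by blast
    then show ?thesis by (simp add: x_def bform_linear mult.commute)
  qed
  define ratio where "ratio a b = bform M (y a) (y b) / lf \<alpha> (y a * y b)" for a b
  have ratio: "bform M (y a) w = ratio a b * lf \<alpha> (y a * w)"
    if "a \<in> {1,2,3}" "b \<in> {1,2,3}" "a \<noteq> b" "lf \<alpha> w = 0" for a b w
    using proportional[OF that] yy[OF that(1-3)] by (simp add: ratio_def field_simps)
  have rsym: "ratio a b = ratio b a" for a b by (simp add: ratio_def sym[of "y a"] mult.commute)
  have "ratio 1 3 = ratio 1 2"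
    using ratio[of 1 2 "y 3"] yy[of 1 3] ly by (simp add: ratio_def)
  then have *: "bform M (y n) w = ratio 1 2 * lf \<alpha> (y n * w)" if "n \<in> {1,2,3}" "lf \<alpha> w = 0" for n w
    using ratio[of 1 2 w] ratio[of 2 1 w] ratio[of 3 1 w] rsym[of 3 1] rsym[of 2 1] that by auto
  show ?thesis
  proof (rule that)
    show "ratio 1 2 \<noteq> 0"
      using same_kernel[of 1 "y 2"] *[of 1 "y 2"] yy[of 1 2] ly by auto
    fix v w assume v: "lf \<alpha> v = 0" and w: "lf \<alpha> w = 0"
    have perm: "{5, 1, 2, 3, 4} = {1..5::nat}" by auto
    obtain a b c where "v = a *s y 1 + b *s y 2 + c *s y 3"
      using plane_expand[OF nd perm v] unfolding y_def by blast
    then show "bform M v w = ratio 1 2 * lf \<alpha> (v * w)"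
      using *[OF _ w] by (simp add: bform_linear distrib_right smult_mult_vec lf_add lf_scale algebra_simps)
  qed
qed

lemma von_Staudt_conic_isomorphism:
  assumes nd: "nondegenerate_plane \<alpha>" and M: "von_Staudt_conic \<alpha> M"
  shows "conic_isomorphism \<alpha> M \<phi> \<longleftrightarrow> conic_isomorphism \<alpha> (diagm \<alpha>) \<phi>"
proof -
  obtain c where "c \<noteq> 0" "\<And>v w. lf \<alpha> v = 0 \<Longrightarrow> lf \<alpha> w = 0 \<Longrightarrow> bform M v w = c * lf \<alpha> (v * w)"
    using von_Staudt_conic_unique[OF assms] by blast
  then have "{z \<in> plane \<alpha>. bform M z z = 0} = {z \<in> plane \<alpha>. bform (diagm \<alpha>) z z = 0}"
    by (auto simp: plane_lf bform_diagm_lf)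
  then show ?thesis unfolding conic_isomorphism_def conic_points_def by simp
qed

section \<open>Special configurations, weights and idempotents\<close>

text \<open>The axis of \<open>p\<^sub>i\<^sub>j\<close> is where the coordinates \<open>i\<close>
  and \<open>j\<close> agree, and for \<open>vertex \<alpha> i j\<close> their difference is the sum
  of the two weights.\<close>

lemma special_configuration_iff_weight:
  assumes nd: "nondegenerate_plane \<alpha>"
  shows "special_configuration \<alpha> \<longleftrightarrow>
    (\<exists>i\<in>{1..5}. \<exists>j\<in>{1..5}. i \<noteq> j \<and> weight \<alpha> i + weight \<alpha> j = 0)"
proof -
  have *: "conf_point \<alpha> i j \<subseteq> conf_line \<alpha> k l m \<longleftrightarrow> weight \<alpha> i + weight \<alpha> j = 0"
    if perm: "{i, j, k, l, m} = {1..5}" for i j k l m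
  proof -
    note p = perm_15[OF perm]
    have line: "conf_line \<alpha> k l m = {z. coord5 z i = coord5 z j} \<inter> plane \<alpha>"
      using span_base_point[OF p(1-3)] unfolding conf_line_def p(4)[symmetric] by simp
    have v: "coord5 (vertex \<alpha> i j) i - coord5 (vertex \<alpha> i j) j = weight \<alpha> i + weight \<alpha> j"
      using p by (subst coord5_vertex_diff) auto
    have cp: "conf_point \<alpha> i j = {t *s vertex \<alpha> i j | t. True}"
      using conf_point_vertex[OF nd p(1,2)] by blast
    have "conf_point \<alpha> i j \<subseteq> conf_line \<alpha> k l m \<longleftrightarrow>
        (\<forall>t. coord5 (t *s vertex \<alpha> i j) i = coord5 (t *s vertex \<alpha> i j) j)"
      unfolding line cp by (auto simp: plane_lf lf_scale lf_vertex)
    also have "\<dots> \<longleftrightarrow> coord5 (vertex \<alpha> i j) i = coord5 (vertex \<alpha> i j) j"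
      by (auto simp: coord5_linear dest: spec[of _ 1])
    finally show ?thesis unfolding v[symmetric] by simp
  qed
  show ?thesis unfolding special_configuration_def
  proof (intro iffI; elim exE conjE bexE)
    fix i j k l m
    assume perm: "{i, j, k, l, m} = {1..5}" and "conf_point \<alpha> i j \<subseteq> conf_line \<alpha> k l m"
    then have "i \<noteq> j \<and> weight \<alpha> i + weight \<alpha> j = 0" using *[OF perm] perm_15(3)[OF perm] by simp
    then show "\<exists>i\<in>{1..5}. \<exists>j\<in>{1..5}. i \<noteq> j \<and> weight \<alpha> i + weight \<alpha> j = 0"
      using perm_15(1,2)[OF perm] by blast
  next
    fix i j :: nat
    assume ij: "i \<in> {1..5}" "j \<in> {1..5}" "i \<noteq> j" and w: "weight \<alpha> i + weight \<alpha> j = 0"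
    obtain k l m where perm: "{i, j, k, l, m} = {1..5}" using perm_15_exists[OF ij] .
    show "\<exists>i j k l m. {i, j, k, l, m} = {1..5} \<and> conf_point \<alpha> i j \<subseteq> conf_line \<alpha> k l m"
      by (intro exI conjI, rule perm) (simp add: *[OF perm] w)
  qed
qed

text \<open>Idempotents are the 0-1 vectors. One or four ones are excluded by nondegeneracy. Two
  ones give a pair of opposite weights; three give the complementary pair, which contains the index
  \<open>5\<close>, as the weights sum to zero.\<close>

lemma special_configuration_iff_idempotent:
  assumes nd: "nondegenerate_plane \<alpha>"
  shows "special_configuration \<alpha> \<longleftrightarrow> (\<exists>e. e \<noteq> 0 \<and> lf \<alpha> e = 0 \<and> e * e = e)"
  unfolding special_configuration_iff_weight[OF nd]
proof
  assume "\<exists>i\<in>{1..5}. \<exists>j\<in>{1..5}. i \<noteq> j \<and> weight \<alpha> i + weight \<alpha> j = 0"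
  then obtain i j where ij: "i \<in> {1..5}" "j \<in> {1..5}" "i \<noteq> j" and w: "weight \<alpha> i + weight \<alpha> j = 0"
    by blast
  \<comment> \<open>If the index \<open>5\<close> occurs, the sum of the frame vectors has entries
    \<open>0\<close> and \<open>- 1\<close>, so its sign is changed.\<close>
  define e where "e = (if i = 5 \<or> j = 5 then - 1 else 1 :: complex) *s (frame_vec i + frame_vec j)"
  have "e * e = e \<and> e \<noteq> 0"
    using ij unfolding nat_15 e_def frame_vec_def base_point_def
    by (elim disjE) (simp_all add: vec_eq_iff forall_4 axis_def del: not_all)
  moreover have "lf \<alpha> e = 0"
    unfolding e_def lf_scale lf_add using w by (simp add: weight_def)
  ultimately show "\<exists>e. e \<noteq> 0 \<and> lf \<alpha> e = 0 \<and> e * e = e" by blast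
next
  assume "\<exists>e. e \<noteq> 0 \<and> lf \<alpha> e = 0 \<and> e * e = e"
  then obtain e where e: "e \<noteq> 0" "lf \<alpha> e = 0" "e * e = e" by blast
  have "e $ n = 0 \<or> e $ n = 1" for n
  proof -
    have "e $ n * e $ n = e $ n" using e(3) by (metis vector_mult_component)
    then show ?thesis by simp
  qed
  note c = this[of 1] this[of 2] this[of 3] this[of 4]
  have nz: "\<alpha>$1 \<noteq> 0" "\<alpha>$2 \<noteq> 0" "\<alpha>$3 \<noteq> 0" "\<alpha>$4 \<noteq> 0"
    using weight_nonzero[OF nd, of 1] weight_nonzero[OF nd, of 2] weight_nonzero[OF nd, of 3]
      weight_nonzero[OF nd, of 4] by (simp_all add: weight_eq)
  have nz5: "\<alpha>$1 + \<alpha>$2 + \<alpha>$3 + \<alpha>$4 \<noteq> 0"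
    using weight_nonzero[OF nd, of 5] unfolding weight_eq neg_equal_0_iff_equal by simp
  have l: "\<alpha>$1 * e$1 + \<alpha>$2 * e$2 + \<alpha>$3 * e$3 + \<alpha>$4 * e$4 = 0"
    using e(2) by (simp add: lf_def sum_4)
  have "e$1 \<noteq> 0 \<or> e$2 \<noteq> 0 \<or> e$3 \<noteq> 0 \<or> e$4 \<noteq> 0"
    using e(1) by (auto simp: vec_eq_iff forall_4)
  then have disj: "\<alpha>$1 + \<alpha>$2 = 0 \<or> \<alpha>$1 + \<alpha>$3 = 0 \<or> \<alpha>$1 + \<alpha>$4 = 0 \<or> \<alpha>$2 + \<alpha>$3 = 0 \<or> \<alpha>$2 + \<alpha>$4 = 0 \<or>
      \<alpha>$3 + \<alpha>$4 = 0 \<or> \<alpha>$1 + \<alpha>$2 + \<alpha>$3 = 0 \<or> \<alpha>$1 + \<alpha>$2 + \<alpha>$4 = 0 \<or> \<alpha>$1 + \<alpha>$3 + \<alpha>$4 = 0 \<or>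
      \<alpha>$2 + \<alpha>$3 + \<alpha>$4 = 0"
    using c l nz nz5 by (elim disjE[of "_ = _"]) simp_all
  have triples:
    "\<alpha>$1 + \<alpha>$2 + \<alpha>$3 = - (weight \<alpha> 4 + weight \<alpha> 5)" "\<alpha>$1 + \<alpha>$2 + \<alpha>$4 = - (weight \<alpha> 3 + weight \<alpha> 5)"
    "\<alpha>$1 + \<alpha>$3 + \<alpha>$4 = - (weight \<alpha> 2 + weight \<alpha> 5)" "\<alpha>$2 + \<alpha>$3 + \<alpha>$4 = - (weight \<alpha> 1 + weight \<alpha> 5)"
    by (simp_all add: weight_eq)
  have pairs: "\<alpha>$1 + x = weight \<alpha> 1 + x" "\<alpha>$2 + x = weight \<alpha> 2 + x"
    "\<alpha>$3 + x = weight \<alpha> 3 + x" "x + \<alpha>$2 = x + weight \<alpha> 2" "x + \<alpha>$3 = x + weight \<alpha> 3"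
    "x + \<alpha>$4 = x + weight \<alpha> 4" for x
    by (simp_all add: weight_eq)
  have goal: "\<exists>i\<in>{1..5}. \<exists>j\<in>{1..5}. i \<noteq> j \<and> weight \<alpha> i + weight \<alpha> j = 0"
    if "weight \<alpha> i + weight \<alpha> j = 0" "i \<in> {1..5}" "j \<in> {1..5}" "i \<noteq> j" for i j
    using that by blast
  show "\<exists>i\<in>{1..5}. \<exists>j\<in>{1..5}. i \<noteq> j \<and> weight \<alpha> i + weight \<alpha> j = 0"
    using disj unfolding triples neg_equal_0_iff_equal unfolding pairs
    by - (elim disjE; erule goal; simp)
qed

subsection \<open>The Jacobian sextic\<close>

text \<open>Entry \<open>k\<close> is the coefficient of \<open>t ^ k * s ^ (6 - k)\<close> when the
  cubic form \<open>lf \<alpha> (x * x * x)\<close> is restricted to the parametrized conic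
  (\<open>lf_cube_expand\<close>).\<close>

definition cube_coeff :: "complex^4 \<Rightarrow> complex^4 \<Rightarrow> complex^4 \<Rightarrow> complex^4 \<Rightarrow> nat \<Rightarrow> complex" where
  "cube_coeff \<alpha> z w u k =
    [lf \<alpha> (z * z * z), 3 * lf \<alpha> (z * z * w), 3 * (lf \<alpha> (z * z * u) + lf \<alpha> (z * w * w)),
     6 * lf \<alpha> (z * w * u) + lf \<alpha> (w * w * w), 3 * (lf \<alpha> (z * u * u) + lf \<alpha> (w * w * u)),
     3 * lf \<alpha> (w * u * u), lf \<alpha> (u * u * u)] ! k"

lemma lf_cube_expand:
  assumes x: "x = s\<^sup>2 *s z + (s * t) *s w + t\<^sup>2 *s u"
  shows "lf \<alpha> (x * x * x) = (\<Sum>k\<le>6. cube_coeff \<alpha> z w u k * t ^ k * s ^ (6 - k))"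
proof -
  have "x * x * x = s ^ 6 *s (z * z * z) + (3 * (t * s ^ 5)) *s (z * z * w) +
      (3 * (t ^ 2 * s ^ 4)) *s (z * z * u + z * w * w) +
      (t ^ 3 * s ^ 3) *s (6 *s (z * w * u) + w * w * w) +
      (3 * (t ^ 4 * s ^ 2)) *s (z * u * u + w * w * u) +
      (3 * (t ^ 5 * s)) *s (w * u * u) + t ^ 6 *s (u * u * u)"
    unfolding x vec_eq_iff
    by (simp add: eval_nat_numeral algebra_simps)
  then show ?thesis
    by (simp add: lf_add lf_scale cube_coeff_def eval_nat_numeral algebra_simps)
qed

text \<open>If the first two coefficients vanish, the third does not, by
  \<open>conic_basis_double\<close>. Needed to show that two quartics spanning the pencil are
  independent.\<close>

lemma cube_not_identically_zero:
  assumes nd: "nondegenerate_plane \<alpha>" and cb: "conic_basis \<alpha> z w u"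
    and x: "\<And>t. x t = z + t *s w + t\<^sup>2 *s u"
  shows "\<exists>t. lf \<alpha> (x t * x t * x t) \<noteq> 0"
proof (rule ccontr)
  assume "\<not> ?thesis"
  then have "(\<Sum>k\<le>6. cube_coeff \<alpha> z w u k * t ^ k) = 0" for t
    using lf_cube_expand[of "x t" 1 z t w u \<alpha>] x by simp
  then have "\<forall>k\<le>6. cube_coeff \<alpha> z w u k = 0" using polyfun_eq_0 by blast
  then have "cube_coeff \<alpha> z w u 0 = 0" "cube_coeff \<alpha> z w u 1 = 0" "cube_coeff \<alpha> z w u 2 = 0"
    by simp_all
  then show False using conic_basis_double(1)[OF nd cb]
    by (simp add: cube_coeff_def del: distrib_left_numeral)
qed

text \<open>The quartics are pencil forms, so their Jacobian is a volume of
  \<open>\<phi> v * \<phi> v\<close> with tangent vectors, which \<open>vol_conic_basis\<close>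
  turns into the cubic form. The index \<open>i\<close> and the spanning pair only enter the
  constant.\<close>

lemma jacobian_sextic_eq_cube:
  assumes nd: "nondegenerate_plane \<alpha>" and iso: "conic_isomorphism \<alpha> (diagm \<alpha>) \<phi>" and i: "i \<in> {1..5}"
    and f: "restricted_pencil \<alpha> \<phi> i = {(\<lambda>v. a * f 1 v + b * f 2 v) | a b. True}"
  obtains \<kappa> where "\<kappa> \<noteq> 0" "\<And>v. jacobian_det f v = \<kappa> * lf \<alpha> (\<phi> v * \<phi> v * \<phi> v)"
proof -
  let ?p = "axis 1 1 :: complex^2" and ?q = "axis 2 1 :: complex^2"
  define a where "a = \<phi> ?p"
  define c where "c = \<phi> ?q"
  obtain d where cb: "conic_basis \<alpha> a d c"
    and ex: "\<And>s t. \<phi> (s *s ?p + t *s ?q) = s\<^sup>2 *s a + (s * t) *s d + t\<^sup>2 *s c"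
    unfolding a_def c_def
    by (rule conic_isomorphism_basis[OF nd iso, of ?p ?q]) (simp_all add: axis_def)
  have \<phi>: "\<phi> v = (v$1)\<^sup>2 *s a + (v$1 * v$2) *s d + (v$2)\<^sup>2 *s c" for v
  proof -
    have "v = v$1 *s ?p + v$2 *s ?q" by (simp add: vec_eq_iff forall_2 axis_def)
    then show ?thesis using ex by metis
  qed
  have l\<phi>: "lf \<alpha> (\<phi> v) = 0" for v
    using cb by (simp add: \<phi> lf_add lf_scale conic_basis_def)
  have l\<phi>2: "lf \<alpha> (\<phi> v * \<phi> v) = 0" for v
  proof -
    have "lf \<alpha> (\<phi> v * \<phi> v) = (v$1)\<^sup>2 * lf \<alpha> (a * \<phi> v) + v$1 * v$2 * lf \<alpha> (d * \<phi> v) +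
        (v$2)\<^sup>2 * lf \<alpha> (c * \<phi> v)"
      by (subst \<phi>) (simp add: distrib_right smult_mult_vec lf_add lf_scale)
    then show ?thesis
      unfolding \<phi> conic_basis_expand[OF cb] by (simp add: power2_eq_square algebra_simps)
  qed
  obtain j where "j \<in> {1..5::nat}" "i \<noteq> j"
    using i by (cases "i = 1") (auto intro: that[of 1] that[of 2])
  then obtain k l m where perm: "{i, j, k, l, m} = {1..5}" using perm_15_exists i by metis
  define T where "T = vol j k l m a d c"
  \<comment> \<open>Three vertices lie in the span of \<open>a\<close>, \<open>d\<close>,
    \<open>c\<close>, so their nonzero volume is a multiple of \<open>T\<close>.\<close>
  have T: "T \<noteq> 0"
  proof -
    obtain r1 s1 t1 r2 s2 t2 r3 s3 t3 where
      "vertex \<alpha> i j = r1 *s a + s1 *s d + t1 *s c" "vertex \<alpha> i k = r2 *s a + s2 *s d + t2 *s c"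
      "vertex \<alpha> i l = r3 *s a + s3 *s d + t3 *s c"
      using conic_basis_spans[OF nd cb lf_vertex] by metis
    then show ?thesis
      using vol_vertices_nonzero[OF nd perm] unfolding T_def by (simp add: vol_combination)
  qed
  have ac: "lf \<alpha> (a * c) \<noteq> 0" using cb by (simp add: conic_basis_def)
  have jac: "lf \<alpha> (a * c) * jacobian_det h v =
      4 * (r 1 * s 2 - r 2 * s 1) * T * lf \<alpha> (\<phi> v * \<phi> v * \<phi> v)"
    if h: "\<And>n v. h n v = pencil_form j k l m (r n) (s n) (\<phi> v)" for h r s v
  proof -
    let ?V = "vol j k l m (\<phi> v * \<phi> v) ((2 * v$1) *s a + v$2 *s d) (v$1 *s d + (2 * v$2) *s c)"
    have "lf \<alpha> (a * c) * jacobian_det h v = 2 * (r 1 * s 2 - r 2 * s 1) * (lf \<alpha> (a * c) * ?V)"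
      unfolding jacobian_det_pencil_form[of \<phi> a d c h, OF \<phi> h] by (simp only: ac_simps)
    also have "lf \<alpha> (a * c) * ?V = 2 * T * lf \<alpha> (\<phi> v * (\<phi> v * \<phi> v))"
      using vol_conic_basis[OF nd cb l\<phi>2[of v], of j k l m "v$1" "v$2", folded \<phi> T_def] .
    finally show ?thesis by (simp add: mult.assoc)
  qed
  have "\<exists>r s. \<forall>v. f n v = pencil_form j k l m r s (\<phi> v)" for n
  proof -
    have "f n = (\<lambda>v. (if n = 1 then 1 else 0) * f 1 v + (if n = 1 then 0 else 1) * f 2 v)"
      using exhaust_2[of n] by auto
    then have "f n \<in> restricted_pencil \<alpha> \<phi> i" unfolding f by blast
    then obtain N where N: "f n = (\<lambda>v. bform N (\<phi> v) (\<phi> v))"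
      "\<forall>j\<in>{1..5} - {i}. \<forall>z\<in>conf_point \<alpha> i j. bform N z z = 0"
      unfolding restricted_pencil_def by blast
    show ?thesis using pencil_form_of_vanishing[OF nd perm N(2)] l\<phi> by (auto simp: N(1))
  qed
  then obtain r s where rs: "\<And>n v. f n v = pencil_form j k l m (r n) (s n) (\<phi> v)" by metis
  \<comment> \<open>The converse inclusion: the standard generators of the pencil are combinations
    of \<open>f 1\<close> and \<open>f 2\<close>.\<close>
  have pencil: "\<exists>u v. \<forall>x. pencil_form j k l m r' s' (\<phi> x) = u * f 1 x + v * f 2 x" for r' s'
  proof -
    obtain N where N: "\<forall>z. bform N z z = pencil_form j k l m r' s' z"
      "\<forall>n\<in>{1..5} - {i}. \<forall>z\<in>conf_point \<alpha> i n. bform N z z = 0"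
      using pencil_form_vanishing[OF nd perm] by blast
    then have "(\<lambda>v. bform N (\<phi> v) (\<phi> v)) \<in> restricted_pencil \<alpha> \<phi> i"
      unfolding restricted_pencil_def by blast
    then obtain u v where "(\<lambda>v. bform N (\<phi> v) (\<phi> v)) = (\<lambda>x. u * f 1 x + v * f 2 x)"
      unfolding f by blast
    then show ?thesis using N(1) by metis
  qed
  obtain u1 v1 where 1: "\<And>x. pencil_form j k l m 1 0 (\<phi> x) = u1 * f 1 x + v1 * f 2 x"
    using pencil by metis
  obtain u2 v2 where 2: "\<And>x. pencil_form j k l m 0 1 (\<phi> x) = u2 * f 1 x + v2 * f 2 x"
    using pencil by metis
  obtain x where x: "lf \<alpha> (\<phi> x * \<phi> x * \<phi> x) \<noteq> 0"
  proof -
    have "\<phi> (1 *s ?p + t *s ?q) = a + t *s d + t\<^sup>2 *s c" for t unfolding ex by simp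
    from cube_not_identically_zero[OF nd cb this] show ?thesis using that by blast
  qed
  \<comment> \<open>If \<open>f 1\<close> and \<open>f 2\<close> were dependent, so would be the standard generators of the pencil, and
    their Jacobian, a nonzero multiple of the cubic form, would vanish identically.\<close>
  have D: "r 1 * s 2 - r 2 * s 1 \<noteq> 0"
  proof
    assume D: "r 1 * s 2 - r 2 * s 1 = 0"
    define h where "h n y = pencil_form j k l m (if n = 1 then 1 else 0) (if n = 1 then 0 else 1) (\<phi> y)"
      for n :: 2 and y
    have "h n y = pencil_form j k l m (if n = 1 then u1 * r 1 + v1 * r 2 else u2 * r 1 + v2 * r 2)
        (if n = 1 then u1 * s 1 + v1 * s 2 else u2 * s 1 + v2 * s 2) (\<phi> y)" for n y
      unfolding h_def using 1[of y] 2[of y] rs[of 1 y] rs[of 2 y]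
      by (simp add: pencil_form_def algebra_simps)
    from jac[of h, OF this, of x]
    have "lf \<alpha> (a * c) * jacobian_det h x = 4 * ((u1 * r 1 + v1 * r 2) * (u2 * s 1 + v2 * s 2) -
        (u2 * r 1 + v2 * r 2) * (u1 * s 1 + v1 * s 2)) * T * lf \<alpha> (\<phi> x * \<phi> x * \<phi> x)"
      by simp
    also have "(u1 * r 1 + v1 * r 2) * (u2 * s 1 + v2 * s 2) -
        (u2 * r 1 + v2 * r 2) * (u1 * s 1 + v1 * s 2) =
        (u1 * v2 - u2 * v1) * (r 1 * s 2 - r 2 * s 1)"
      by (simp add: algebra_simps)
    finally show False using D jac[of h, OF h_def, of x] T x by simp
  qed
  show ?thesis
  proof (rule that)
    show "4 * (r 1 * s 2 - r 2 * s 1) * T / lf \<alpha> (a * c) \<noteq> 0" using D T ac by simp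
    show "jacobian_det f v = 4 * (r 1 * s 2 - r 2 * s 1) * T / lf \<alpha> (a * c) *
      lf \<alpha> (\<phi> v * \<phi> v * \<phi> v)" for v
    proof -
      have "jacobian_det f v = lf \<alpha> (a * c) * jacobian_det f v / lf \<alpha> (a * c)" using ac by simp
      then show ?thesis unfolding jac[where v = v, OF rs] by simp
    qed
  qed
qed

lemma normalized_complement:
  fixes p :: "complex^2"
  assumes "p \<noteq> 0"
  obtains q :: "complex^2" where "p$2 * q$1 - p$1 * q$2 = 1"
proof (cases "p$2 = 0")
  case True
  then have "p$1 \<noteq> 0" using assms by (auto simp: vec_eq_iff forall_2)
  then show ?thesis using that[of "(- 1 / p$1) *s axis 2 1"] True by (simp add: axis_def)
next
  case False
  then show ?thesis using that[of "(1 / p$2) *s axis 1 1"] by (simp add: axis_def)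
qed

theorem theorem6p1:
  fixes \<alpha> :: "complex^4" and J :: "complex^2 \<Rightarrow> complex"
  assumes "nondegenerate_plane \<alpha>" and "J \<in> jacobian_sextics \<alpha>"
  shows "special_configuration \<alpha> \<longleftrightarrow> has_double_root 6 J"
proof -
  note nd = assms(1)
  obtain f M \<phi> i where J: "J = jacobian_det f" and M: "von_Staudt_conic \<alpha> M"
    and isoM: "conic_isomorphism \<alpha> M \<phi>" and i: "i \<in> {1..5}"
    and f: "restricted_pencil \<alpha> \<phi> i = {(\<lambda>v. a * f 1 v + b * f 2 v) | a b. True}"
    using assms(2) unfolding jacobian_sextics_def by blast
  have iso: "conic_isomorphism \<alpha> (diagm \<alpha>) \<phi>"
    using isoM von_Staudt_conic_isomorphism[OF nd M] by simp
  obtain \<kappa> where \<kappa>: "\<kappa> \<noteq> 0" and J\<kappa>: "\<And>v. J v = \<kappa> * lf \<alpha> (\<phi> v * \<phi> v * \<phi> v)"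
    using jacobian_sextic_eq_cube[OF nd iso i f] unfolding J by blast
  \<comment> \<open>At every point the coefficients of \<open>J\<close> in an adapted basis are
    \<open>\<kappa>\<close> times those of the cubic form.\<close>
  have expansion: "\<exists>(q :: complex^2) w. p$2 * q$1 - p$1 * q$2 = 1 \<and> conic_basis \<alpha> (\<phi> p) w (\<phi> q) \<and>
      (\<forall>s t. J (s *s p + t *s q) =
        (\<Sum>k\<le>6. \<kappa> * cube_coeff \<alpha> (\<phi> p) w (\<phi> q) k * t ^ k * s ^ (6 - k)))"
    if p: "p \<noteq> 0" for p
  proof -
    obtain q :: "complex^2" where q: "p$2 * q$1 - p$1 * q$2 = 1" using normalized_complement[OF p] .
    then have "p$2 * q$1 - p$1 * q$2 \<noteq> 0" by simp
    from conic_isomorphism_basis[OF nd iso this] obtain w where cb: "conic_basis \<alpha> (\<phi> p) w (\<phi> q)"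
      and ex: "\<And>s t. \<phi> (s *s p + t *s q) = s\<^sup>2 *s \<phi> p + (s * t) *s w + t\<^sup>2 *s \<phi> q" by blast
    have "J (s *s p + t *s q) = (\<Sum>k\<le>6. \<kappa> * cube_coeff \<alpha> (\<phi> p) w (\<phi> q) k * t ^ k * s ^ (6 - k))"
      for s t
      unfolding J\<kappa> lf_cube_expand[OF ex] by (simp add: sum_distrib_left mult.assoc)
    then show ?thesis using q cb by blast
  qed
  show ?thesis
  proof
    assume "special_configuration \<alpha>"
    then obtain e where e: "e \<noteq> 0" "lf \<alpha> e = 0" "e * e = e"
      using special_configuration_iff_idempotent[OF nd] by blast
    \<comment> \<open>An idempotent of the plane lies on the conic, so the parametrization reaches
      it.\<close>
    then have "lf \<alpha> (e * e) = 0" by simp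
    from conic_isomorphism_onto[OF iso e(1,2) this] obtain p r where p: "p \<noteq> 0" "\<phi> p = r *s e" .
    obtain q w where q: "p$2 * q$1 - p$1 * q$2 = 1" and cb: "conic_basis \<alpha> (\<phi> p) w (\<phi> q)"
      and ex: "\<And>s t. J (s *s p + t *s q) =
        (\<Sum>k\<le>6. \<kappa> * cube_coeff \<alpha> (\<phi> p) w (\<phi> q) k * t ^ k * s ^ (6 - k))"
      using expansion[OF p(1)] by blast
    note c01 = conic_basis_idempotent[OF nd cb p(2) e(3)]
    \<comment> \<open>The coefficient of \<open>t ^ 2\<close> does not vanish, by
      \<open>conic_basis_double\<close>, so the multiplicity is exactly two.\<close>
    have "root_of_multiplicity 6 2 J p"
      by (rule root_of_multiplicity_2_coeffs(1)[OF q ex])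
        (use c01 conic_basis_double(1)[OF nd cb c01] \<kappa> in \<open>simp_all add: cube_coeff_def del: distrib_left_numeral\<close>)
    then show "has_double_root 6 J" unfolding has_double_root_def by blast
  next
    assume "has_double_root 6 J"
    then obtain p where root: "root_of_multiplicity 6 2 J p" unfolding has_double_root_def by blast
    then have "p \<noteq> 0" by (simp add: root_of_multiplicity_def)
    from expansion[OF this]
    obtain q w where q: "p$2 * q$1 - p$1 * q$2 = 1" and cb: "conic_basis \<alpha> (\<phi> p) w (\<phi> q)"
      and ex: "\<And>s t. J (s *s p + t *s q) =
        (\<Sum>k\<le>6. \<kappa> * cube_coeff \<alpha> (\<phi> p) w (\<phi> q) k * t ^ k * s ^ (6 - k))"
      by blast
    have "lf \<alpha> (\<phi> p * \<phi> p * \<phi> p) = 0" "lf \<alpha> (\<phi> p * \<phi> p * w) = 0"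
      using root_of_multiplicity_2_coeffs(2)[OF q ex root] \<kappa>
      by (simp_all add: cube_coeff_def)
    then show "special_configuration \<alpha>"
      using conic_basis_double(2)[OF nd cb] special_configuration_iff_idempotent[OF nd] by blast
  qed
qed

end
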